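(* Let $1<\alpha<2$. Let $u\in C^{[\alpha]+4}(\mathbb{R})$ be such that all derivatives of $u$ up to order $[\alpha]+5$ belong to $L_1(\mathbb{R})$. Then, as $h\to 0^+$, $${}^{L}\widetilde{\mathcal{B}}_{2}^{\alpha}u(x)=\widetilde{\mathcal{L}}\,{}_{RL}D_{-\infty,x}^{\alpha}u(x)+\mathcal{O}(h^3)$$ and $${}^{R}\widetilde{\mathcal{B}}_{2}^{\alpha}u(x)=\widetilde{\mathcal{L}}\,{}_{RL}D_{x,+\infty}^{\alpha}u(x)+\mathcal{O}(h^3)$$ uniformly for $x\in\mathbb{R}$.
   Context: $[\alpha]$ is the integer part of $\alpha$; $h>0$ is the step size. For $1<\alpha<2$ the left and right Riemann-Liouville derivatives on $\mathbb{R}$ are $${}_{RL}D_{-\infty,x}^{\alpha}u(x)=\frac{1}{\Gamma(2-\alpha)}\frac{d^2}{dx^2}\int_{-\infty}^{x}\frac{u(s)\,ds}{(x-s)^{\alpha-1}},\qquad {}_{RL}D_{x,+\infty}^{\alpha}u(x)=\frac{1}{\Gamma(2-\alpha)}\frac{d^2}{dx^2}\int_{x}^{+\infty}\frac{u(s)\,ds}{(s-x)^{\alpha-1}}.$$ The coefficients $\widetilde{\kappa}_{2,\ell}^{(\alpha)}$ are defined by $$\left(\frac{3\alpha+2}{2\alpha}-\frac{2(\alpha+1)}{\alpha}z+\frac{\alpha+2}{2\alpha}z^2\right)^{\alpha}=\sum_{\ell=0}^{\infty}\widetilde{\kappa}_{2,\ell}^{(\alpha)}z^\ell,\quad|z|<1.$$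 The difference operators are $${}^{L}\widetilde{\mathcal{B}}_{2}^{\alpha}u(x)=\frac{1}{h^{\alpha}}\sum_{\ell=0}^{\infty}\widetilde{\kappa}_{2,\ell}^{(\alpha)}u(x-(\ell+1)h),\qquad {}^{R}\widetilde{\mathcal{B}}_{2}^{\alpha}u(x)=\frac{1}{h^{\alpha}}\sum_{\ell=0}^{\infty}\widetilde{\kappa}_{2,\ell}^{(\alpha)}u(x+(\ell+1)h).$$ The operator $\widetilde{\mathcal{L}}$ is $\widetilde{\mathcal{L}}v(x)=(1+\widetilde{\sigma}_2^{(\alpha)}h^2\delta_x^2)v(x)$, where $\delta_x^2v(x)=\frac{v(x+h)-2v(x)+v(x-h)}{h^2}$ and $\widetilde{\sigma}_2^{(\alpha)}=-\frac{2\alpha^2+6\alpha+3}{6\alpha}$. *)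

theory Defs
  imports "HOL-Complex_Analysis.Complex_Analysis"
begin

definition C_k :: "nat \<Rightarrow> (real \<Rightarrow> real) \<Rightarrow> bool" where
  "C_k k u \<longleftrightarrow> (\<forall>j<k. \<forall>x. (deriv ^^ j) u differentiable (at x)) \<and> continuous_on UNIV ((deriv ^^ k) u)"

(* D j is the j-th derivative of u.  For u of class C^(n-1) the functions D 0, ..., D (n-1) are
   the classical derivatives, and D n is the almost-everywhere (equivalently weak) derivative of
   the absolutely continuous function D (n-1); it need not exist at every point.
   Some link between D n and D (n-1) stronger than a.e. differentiability is indispensable,
   because of Cantor-type functions; a classical derivative that exists everywhere and
   lies in L1 satisfies the integral identity. *)
definition derivs_in_L1 :: "nat \<Rightarrow> (real \<Rightarrow> real) \<Rightarrow> bool" where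
  "derivs_in_L1 n u \<longleftrightarrow>
     (\<exists>D :: nat \<Rightarrow> real \<Rightarrow> real. D 0 = u \<and>
        (\<forall>j\<le>n. integrable lborel (D j)) \<and>
        (\<forall>j<n. \<forall>a b. a \<le> b \<longrightarrow> D j b - D j a = (LINT s:{a..b}|lborel. D (Suc j) s)))"

definition RL_left :: "real \<Rightarrow> (real \<Rightarrow> real) \<Rightarrow> real \<Rightarrow> real" where
  "RL_left \<alpha> u x =
     1 / Gamma (2 - \<alpha>) *
       (deriv ^^ 2) (\<lambda>y. LINT s:{..<y}|lborel. u s / (y - s) powr (\<alpha> - 1)) x"

definition RL_right :: "real \<Rightarrow> (real \<Rightarrow> real) \<Rightarrow> real \<Rightarrow> real" where
  "RL_right \<alpha> u x =
     1 / Gamma (2 - \<alpha>) *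
       (deriv ^^ 2) (\<lambda>y. LINT s:{y<..}|lborel. u s / (s - y) powr (\<alpha> - 1)) x"

definition gen_poly :: "real \<Rightarrow> complex \<Rightarrow> complex" where
  "gen_poly \<alpha> z =
     of_real ((3 * \<alpha> + 2) / (2 * \<alpha>)) - of_real (2 * (\<alpha> + 1) / \<alpha>) * z
       + of_real ((\<alpha> + 2) / (2 * \<alpha>)) * z\<^sup>2"

(* Principal branch of the power; gen_poly avoids the branch cut on the unit disc (see below). *)
definition kappa2 :: "real \<Rightarrow> nat \<Rightarrow> real" where
  "kappa2 \<alpha> =
     (THE \<kappa> :: nat \<Rightarrow> real. \<forall>z::complex. norm z < 1 \<longrightarrow>
        (\<lambda>l. of_real (\<kappa> l) * z ^ l) sums (gen_poly \<alpha> z powr of_real \<alpha>))"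

definition B_left :: "real \<Rightarrow> real \<Rightarrow> (real \<Rightarrow> real) \<Rightarrow> real \<Rightarrow> real" where
  "B_left \<alpha> h u x = 1 / h powr \<alpha> * (\<Sum>l. kappa2 \<alpha> l * u (x - real (l + 1) * h))"

definition B_right :: "real \<Rightarrow> real \<Rightarrow> (real \<Rightarrow> real) \<Rightarrow> real \<Rightarrow> real" where
  "B_right \<alpha> h u x = 1 / h powr \<alpha> * (\<Sum>l. kappa2 \<alpha> l * u (x + real (l + 1) * h))"

definition delta_sq :: "real \<Rightarrow> (real \<Rightarrow> real) \<Rightarrow> real \<Rightarrow> real" where
  "delta_sq h v x = (v (x + h) - 2 * v x + v (x - h)) / h\<^sup>2"

definition sigma2 :: "real \<Rightarrow> real" where
  "sigma2 \<alpha> = - (2 * \<alpha>\<^sup>2 + 6 * \<alpha> + 3) / (6 * \<alpha>)"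

definition L_op :: "real \<Rightarrow> real \<Rightarrow> (real \<Rightarrow> real) \<Rightarrow> real \<Rightarrow> real" where
  "L_op \<alpha> h v x = v x + sigma2 \<alpha> * h\<^sup>2 * delta_sq h v x"


lemma gen_poly_not_nonpos_Reals:
  assumes "\<alpha> > 0" "norm z < 1"
  shows "gen_poly \<alpha> z \<notin> \<real>\<^sub>\<le>\<^sub>0"
proof
  assume A: "gen_poly \<alpha> z \<in> \<real>\<^sub>\<le>\<^sub>0"
  define x y where "x = Re z" and "y = Im z"
  have z: "z = Complex x y" by (simp add: x_def y_def)
  have x1: "x < 1" using assms(2) complex_Re_le_cmod[of z] by (simp add: x_def)
  have im: "Im (gen_poly \<alpha> z) = y * ((\<alpha> + 2) * x - 2 * (\<alpha> + 1)) / \<alpha>"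
    using assms(1) by (simp add: gen_poly_def z power2_eq_square field_simps)
  have "(\<alpha> + 2) * x < (\<alpha> + 2) * 1"
    using x1 assms(1) by (intro mult_strict_left_mono) auto
  hence "(\<alpha> + 2) * x - 2 * (\<alpha> + 1) < 0" using assms(1) by (simp only: ring_distribs)
  hence "(\<alpha> + 2) * x - 2 * (\<alpha> + 1) \<noteq> 0" by (rule less_imp_neq)
  moreover have "Im (gen_poly \<alpha> z) = 0"
    using A by (simp add: complex_nonpos_Reals_iff)
  ultimately have y0: "y = 0" using im assms(1) by auto
  have "Re (gen_poly \<alpha> z) = (1 - x) * ((3 * \<alpha> + 2) - (\<alpha> + 2) * x) / (2 * \<alpha>)"
    using assms(1) y0 by (simp add: gen_poly_def z power2_eq_square field_simps)
  moreover have "(3 * \<alpha> + 2) - (\<alpha> + 2) * x > 0"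
    using \<open>(\<alpha> + 2) * x < (\<alpha> + 2) * 1\<close> assms(1) by (simp only: ring_distribs)
  ultimately have "Re (gen_poly \<alpha> z) > 0"
    using x1 assms(1) by simp
  thus False using A by (simp add: complex_nonpos_Reals_iff)
qed

lemma power_series_coeff_unique:
  fixes f :: "complex \<Rightarrow> complex"
  assumes "\<And>z. norm z < 1 \<Longrightarrow> (\<lambda>l. a l * z ^ l) sums f z"
    and "\<And>z. norm z < 1 \<Longrightarrow> (\<lambda>l. b l * z ^ l) sums f z"
  shows "a = b"
proof -
  have ev: "\<forall>\<^sub>F z::complex in nhds 0. norm z < 1"
    using eventually_nhds_in_open[of "ball 0 1" "0::complex"] by simp
  have "f has_fps_expansion Abs_fps a"
    by (rule has_fps_expansionI) (use ev assms(1) in \<open>auto elim!: eventually_mono\<close>)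
  moreover have "f has_fps_expansion Abs_fps b"
    by (rule has_fps_expansionI) (use ev assms(2) in \<open>auto elim!: eventually_mono\<close>)
  ultimately have "Abs_fps a = Abs_fps b"
    by (rule fps_expansion_unique_complex)
  thus ?thesis by (metis fps_nth_Abs_fps ext)
qed

lemma kappa2_sums:
  assumes "\<alpha> > 0" "norm z < 1"
  shows "(\<lambda>l. of_real (kappa2 \<alpha> l) * z ^ l) sums (gen_poly \<alpha> z powr of_real \<alpha>)"
proof -
  define f where "f = (\<lambda>z. gen_poly \<alpha> z powr of_real \<alpha>)"
  define a where "a = (\<lambda>l. (deriv ^^ l) f 0 / fact l)"
  have "gen_poly \<alpha> holomorphic_on ball 0 1"
    unfolding gen_poly_def[abs_def] by (intro holomorphic_intros)
  hence holo: "f holomorphic_on ball 0 1"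
    unfolding f_def
    by (intro holomorphic_on_powr holomorphic_intros gen_poly_not_nonpos_Reals assms) auto
  have a: "(\<lambda>l. a l * w ^ l) sums f w" if "norm w < 1" for w
    using holomorphic_power_series[OF holo, of w] that by (simp add: a_def)
  have f_cnj: "cnj (f (cnj w)) = f w" if "norm w < 1" for w
  proof -
    have g: "gen_poly \<alpha> (cnj w) = cnj (gen_poly \<alpha> w)"
      by (simp add: gen_poly_def)
    have "gen_poly \<alpha> (cnj w) \<notin> \<real>\<^sub>\<le>\<^sub>0"
      using that assms(1) by (intro gen_poly_not_nonpos_Reals) auto
    hence "Im (gen_poly \<alpha> (cnj w)) = 0 \<Longrightarrow> 0 \<le> Re (gen_poly \<alpha> (cnj w))"
      by (auto simp: complex_nonpos_Reals_iff)
    thus ?thesis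
      unfolding f_def by (subst cnj_powr) (auto simp: g)
  qed
  have "(\<lambda>l. cnj (a l)) = a"
  proof (rule power_series_coeff_unique[of _ f])
    fix w :: complex assume w: "norm w < 1"
    have "(\<lambda>l. cnj (a l * cnj w ^ l)) sums cnj (f (cnj w))"
      using a[of "cnj w"] w by (subst sums_cnj) simp
    thus "(\<lambda>l. cnj (a l) * w ^ l) sums f w"
      using f_cnj[OF w] by simp
  qed (rule a)
  hence real: "of_real (Re (a l)) = a l" for l
    by (metis Reals_cnj_iff of_real_Re)
  let ?P = "\<lambda>\<kappa> :: nat \<Rightarrow> real. \<forall>z::complex. norm z < 1 \<longrightarrow>
        (\<lambda>l. of_real (\<kappa> l) * z ^ l) sums (gen_poly \<alpha> z powr of_real \<alpha>)"
  have "?P (kappa2 \<alpha>)"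
    unfolding kappa2_def
  proof (rule theI[of ?P])
    show P: "?P (\<lambda>l. Re (a l))"
      using a by (simp add: real f_def)
    fix \<kappa> assume "?P \<kappa>"
    with P have "(\<lambda>l. complex_of_real (\<kappa> l)) = (\<lambda>l. of_real (Re (a l)))"
      by (intro power_series_coeff_unique[of _ f]) (auto simp: f_def)
    thus "\<kappa> = (\<lambda>l. Re (a l))" by (metis of_real_eq_iff ext)
  qed
  thus ?thesis using assms(2) by blast
qed

end

theory Submission
  imports Defs "HOL-Probability.Characteristic_Functions"
begin

text \<open>
  The estimate is proved on the Fourier side. A continuous integrable function \<open>u\<close> with six
  integrable derivatives has a transform that is bounded and decays like \<open>\<bar>\<xi>\<bar> powr - 6\<close>
  (\<open>fourier_decay\<close>), so that \<open>u\<close> is recovered by the inversion formula (\<open>fourier_inversion\<close>). Both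
  sides of the claimed expansion are then inverse Fourier integrals of explicit multipliers
      times the
  transform of \<open>u\<close>.

  The left fractional derivative has the multiplier \<open>(\<i>\<xi>) powr \<alpha>\<close> (\<open>RL_left_fourier\<close>): the
      fractional
  integral of order \<open>2 - \<alpha>\<close> has the multiplier \<open>(\<i>\<xi>) powr (\<alpha> - 2)\<close>, obtained from the transform of a
  damped power kernel, and differentiating twice multiplies by \<open>(\<i>\<xi>)\<^sup>2\<close>. The difference operator has
  the multiplier \<open>h powr - \<alpha> * z * gen_poly \<alpha> z powr \<alpha>\<close> with \<open>z
      = exp (- \<i>h\<xi>)\<close> (\<open>B_left_fourier\<close>), by
  passing from the interior of the unit disc to its boundary. The compact operator multiplies by
  \<open>1 + \<sigma> (exp (\<i>h\<xi>) + exp (- \<i>h\<xi>) - 2)\<close>.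

  A Taylor expansion at \<open>0\<close> shows that these multipliers agree up to an error of order
  \<open>h ^ 3 * \<bar>\<xi>\<bar> powr (\<alpha> + 3)\<close>, and away from \<open>0\<close> this bound is trivial (\<open>symbol_err_bound\<close>). Since
  \<open>\<bar>\<xi>\<bar> powr (\<alpha> + 3)\<close> times the transform is integrable, the error is \<open>O(h ^ 3)\<close> uniformly in \<open>x\<close>
  (\<open>left_error_bound\<close>). The right-sided statement follows by the reflection \<open>x \<mapsto> - x\<close>.
\<close>

section \<open>Expansion and bound of the symbol\<close>

lemma has_fps_expansion_bound_cubic:
  fixes f :: "complex \<Rightarrow> complex"
  assumes f: "f has_fps_expansion F"
    and "fps_nth F 0 = 0" "fps_nth F 1 = 0" "fps_nth F 2 = 0"
  shows "\<exists>C \<delta>. \<delta> > 0 \<and> C \<ge> 0 \<and> (\<forall>s. norm s < \<delta> \<longrightarrow> norm (f s) \<le> C * norm s ^ 3)"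
proof -
  define g where "g = (\<lambda>s. if s = 0 then fps_nth F 3 else f s / s ^ 3)"
  have "\<exists>C. \<forall>\<^sub>F s in nhds 0. norm (f s) \<le> C * norm s ^ 3"
  proof (cases "F = 0")
    case True
    hence "\<forall>\<^sub>F s in nhds 0. f s = 0"
      using f by (simp add: has_fps_expansion_0_iff)
    hence "\<forall>\<^sub>F s in nhds 0. norm (f s) \<le> 0 * norm s ^ 3"
      by eventually_elim simp
    thus ?thesis by blast
  next
    case False
    have "F $ i = 0" if "i < 3" for i
      using assms that by (auto simp: less_Suc_eq numeral_3_eq_3 numeral_2_eq_2)
    hence "3 \<le> subdegree F"
      using False by (intro subdegree_geI) auto
    hence "g has_fps_expansion fps_shift 3 F"
      unfolding g_def by (intro has_fps_expansion_shift f) auto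
    hence "(g \<longlongrightarrow> F $ 3) (nhds 0)"
      using has_fps_expansion_imp_tendsto_0 by fastforce
    hence "((\<lambda>s. norm (g s)) \<longlongrightarrow> norm (F $ 3)) (nhds 0)"
      by (rule tendsto_norm)
    hence ev: "\<forall>\<^sub>F s in nhds 0. norm (g s) < norm (F $ 3) + 1"
      by (rule order_tendstoD) simp
    have f0: "f 0 = 0"
      using has_fps_expansion_imp_0_eq_fps_nth_0[OF f] assms by simp
    from ev have "\<forall>\<^sub>F s in nhds 0. norm (f s) \<le> (norm (F $ 3) + 1) * norm s ^ 3"
    proof eventually_elim
      case (elim s)
      thus ?case
        by (cases "s = 0") (auto simp: g_def f0 norm_divide norm_power field_simps)
    qed
    thus ?thesis by blast
  qed
  then obtain C d where d: "d > 0" and C: "\<And>s. dist s 0 < d \<Longrightarrow> norm (f s) \<le> C * norm s ^ 3"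
    unfolding eventually_nhds_metric by blast
  have "norm (f s) \<le> max C 0 * norm s ^ 3" if "norm s < d" for s
    using C[of s] that by (smt (verit) dist_0_norm dist_commute mult_right_mono norm_ge_zero
        zero_le_power max.cobounded1)
  with d show ?thesis by (metis max.cobounded2)
qed

text \<open>
  For small \<open>s = \<i>\<theta>\<close>, the symbol of the shifted difference operator is \<open>s\<^sup>\<alpha>\<close> times
  \<open>exp (- s) * g s powr \<alpha>\<close>, and the symbol of the compact operator applied to the fractional
  derivative is \<open>s\<^sup>\<alpha>\<close> times \<open>1 + \<sigma> (exp s + exp (- s) - 2)\<close>. The two factors agree up to
  and including second order at \<open>0\<close>: the first-order term of \<open>g s powr \<alpha>\<close> is cancelled by the shift
  \<open>exp (- s)\<close>, and the second-order term is what determines the coefficient \<open>\<sigma>\<close>.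
\<close>

lemma symbol_quotient_expansion:
  fixes \<alpha> :: real
  assumes \<alpha>: "\<alpha> > 0"
  defines "g \<equiv> \<lambda>s. if s = 0 then 1 else gen_poly \<alpha> (exp (- s)) / s"
  shows "\<exists>F. (\<lambda>s. exp (- s) * g s powr of_real \<alpha>
                - (1 + of_real (sigma2 \<alpha>) * (exp s + exp (- s) - 2))) has_fps_expansion F \<and>
             fps_nth F 0 = 0 \<and> fps_nth F 1 = 0 \<and> fps_nth F 2 = 0"
    and "\<forall>\<^sub>F s in nhds 0. Re (g s) > 0"
proof -
  define a :: complex where "a = of_real \<alpha>"
  have a: "a \<noteq> 0" using \<alpha> by (simp add: a_def)
  define P where "P = fps_const ((3 * a + 2) / (2 * a)) - fps_const (2 * (a + 1) / a) * fps_exp (-1)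
       + fps_const ((a + 2) / (2 * a)) * fps_exp (-2)"
  have P: "(\<lambda>s. gen_poly \<alpha> (exp (- s))) has_fps_expansion P"
  proof -
    have eq: "gen_poly \<alpha> (exp (- s)) = (3 * a + 2) / (2 * a) - (2 * (a + 1) / a) * exp (-1 * s)
       + ((a + 2) / (2 * a)) * exp (-2 * s)" for s
      by (simp add: gen_poly_def a_def power2_eq_square flip: exp_add)
    show ?thesis
      unfolding eq P_def by (intro fps_expansion_intros)
  qed
  \<comment> \<open>The first coefficients of \<open>gen_poly \<alpha> (exp (- s))\<close> at \<open>s = 0\<close>; division by \<open>s\<close> shifts them.\<close>
  have P0: "P $ 0 = 0" and P1: "P $ 1 = 1" and P2: "P $ 2 = 1 / a" and P3: "P $ 3
      = - (1 / 3 + 1 / a)"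
    using a by (simp_all add: P_def field_simps fact_numeral)
  have sub: "subdegree P \<ge> 1"
    using P0 P1 by (intro subdegree_geI) auto
  define G where "G = fps_shift 1 P"
  have "(\<lambda>s. if s = 0 then 1 else gen_poly \<alpha> (exp (- s)) / s ^ 1) has_fps_expansion G"
    unfolding G_def using sub P1 by (intro has_fps_expansion_shift P) auto
  hence G: "g has_fps_expansion G" unfolding g_def power_one_right .
  have G0: "G $ 0 = 1" and G1: "G $ 1 = 1 / a" and G2: "G $ 2 = - (1 / 3 + 1 / a)"
    using P1 P2 P3 by (simp_all add: G_def eval_nat_numeral)
  have "(g \<longlongrightarrow> G $ 0) (nhds 0)"
    by (rule has_fps_expansion_imp_tendsto_0[OF G])
  hence "((\<lambda>s. Re (g s)) \<longlongrightarrow> Re 1) (nhds 0)"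
    unfolding G0 by (rule tendsto_Re)
  thus "\<forall>\<^sub>F s in nhds 0. Re (g s) > 0"
    by (rule order_tendstoD) simp
  define H where "H = fps_compose (fps_binomial a) (G - 1)"
  have "((\<lambda>x. (1 + x) powr a) \<circ> (\<lambda>s. g s - 1)) has_fps_expansion H"
    unfolding H_def using G0 by (intro fps_expansion_intros G) auto
  hence H: "(\<lambda>s. g s powr a) has_fps_expansion H" by (simp add: o_def)
  define K where "K = G - 1"
  have K: "K $ 0 = 0" "K $ Suc 0 = 1 / a" "K $ Suc (Suc 0) = - (1 / 3 + 1 / a)"
    using G0 G1 G2 by (simp_all add: K_def numeral_2_eq_2)
  have H0: "H $ 0 = 1" and H1: "H $ 1 = 1"
    and H2: "H $ 2 = - a / 3 - 1 / 2 - 1 / (2 * a)"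
    unfolding H_def K_def[symmetric]
    by (simp_all add: fps_compose_nth fps_mult_nth numeral_2_eq_2 gbinomial_Suc K a)
       (use a in \<open>simp add: field_simps\<close>)
  have s: "complex_of_real (sigma2 \<alpha>) = - (2 * a\<^sup>2 + 6 * a + 3) / (6 * a)"
    by (simp add: sigma2_def a_def)
  define F where "F = fps_exp (-1) * H - (1 + fps_const (of_real (sigma2 \<alpha>)) * (fps_exp 1
      + fps_exp (-1) - 2))"
  have "(\<lambda>s. exp (-1 * s) * g s powr a
                - (1 + of_real (sigma2 \<alpha>) * (exp (1 * s) + exp (-1 * s) - 2))) has_fps_expansion F"
    unfolding F_def by (intro fps_expansion_intros H)
  hence "(\<lambda>s. exp (- s) * g s powr of_real \<alpha>
                - (1 + of_real (sigma2 \<alpha>) * (exp s + exp (- s) - 2))) has_fps_expansion F"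
    by (simp add: a_def)
  moreover have "F $ 0 = 0" by (simp add: F_def H0)
  moreover have "F $ 1 = 0"
    using H0 H1 by (simp add: F_def fps_mult_nth numeral_fps_const)
  moreover have "F $ 2 = 0"
    using H0 H1 H2 a by (simp add: F_def fps_mult_nth numeral_fps_const numeral_2_eq_2 s)
       (simp add: field_simps power2_eq_square)
  ultimately show "\<exists>F. (\<lambda>s. exp (- s) * g s powr of_real \<alpha>
                - (1 + of_real (sigma2 \<alpha>) * (exp s + exp (- s) - 2))) has_fps_expansion F \<and>
             fps_nth F 0 = 0 \<and> fps_nth F 1 = 0 \<and> fps_nth F 2 = 0"
    by blast
qed

text \<open>
  The principal argument of a nonzero imaginary number is at most \<open>pi / 2\<close> in modulus
      and that of \<open>g\<close> is
  smaller than \<open>pi / 2\<close>, so the product does not cross the branch cut.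
\<close>

lemma powr_mult_imaginary:
  fixes \<theta> \<alpha> :: real and g :: complex
  assumes "Re g > 0"
  shows "(\<i> * of_real \<theta> * g) powr of_real \<alpha> = (\<i> * of_real \<theta>) powr of_real \<alpha> * g powr of_real \<alpha>"
proof (cases "\<theta> = 0")
  case False
  have g: "g \<noteq> 0" using assms by auto
  have i: "\<i> * of_real \<theta> \<noteq> 0" using False by simp
  have "\<bar>Im (Ln g)\<bar> < pi / 2" using Re_Ln_pos_lt_imp[OF assms] .
  moreover have "\<bar>Im (Ln (\<i> * of_real \<theta>))\<bar> \<le> pi / 2"
    using Re_Ln_pos_le[OF i] by simp
  ultimately have "Im (Ln (\<i> * of_real \<theta>) + Ln g) \<le> pi" "Im (Ln (\<i> * of_real \<theta>) + Ln g) > - pi"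
    by auto
  hence "Ln (\<i> * of_real \<theta> * g) = Ln (\<i> * of_real \<theta>) + Ln g"
    using Ln_times[OF i g] by simp
  thus ?thesis using g i by (simp add: powr_def exp_add ring_distribs)
qed auto

text \<open>
  The Fourier symbol, at the scaled frequency \<open>\<theta> = h\<xi>\<close>, of the difference operator minus the compact
  operator applied to the left fractional derivative. The factor \<open>h powr - \<alpha>\<close> is split off.
\<close>

definition symbol_err :: "real \<Rightarrow> real \<Rightarrow> complex" where
  "symbol_err \<alpha> \<theta> = cis (- \<theta>) * gen_poly \<alpha> (cis (- \<theta>)) powr of_real \<alpha>
     - (\<i> * of_real \<theta>) powr of_real \<alpha> * (1 + of_real (sigma2 \<alpha>) * (cis \<theta> + cis (- \<theta>) - 2))"

lemma norm_i_powr: "norm ((\<i> * of_real \<theta>) powr of_real \<alpha>) = \<bar>\<theta>\<bar> powr \<alpha>"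
  by (subst norm_powr_real_powr') (auto simp: norm_mult)

lemma gen_poly_1:
  assumes "\<alpha> > 0"
  shows "gen_poly \<alpha> 1 = 0"
proof -
  have "gen_poly \<alpha> 1 = of_real ((3 * \<alpha> + 2) / (2 * \<alpha>) - 2 * (\<alpha> + 1) / \<alpha> + (\<alpha> + 2) / (2 * \<alpha>))"
    by (simp add: gen_poly_def)
  also have "(3 * \<alpha> + 2) / (2 * \<alpha>) - 2 * (\<alpha> + 1) / \<alpha> + (\<alpha> + 2) / (2 * \<alpha>) = 0"
    using assms by (simp add: field_simps)
  finally show ?thesis by simp
qed

lemma gen_poly_bounded:
  assumes "\<alpha> > 0"
  shows "\<exists>M. \<forall>z. norm z \<le> 1 \<longrightarrow> norm (gen_poly \<alpha> z powr of_real \<alpha>) \<le> M"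
proof -
  define N where "N = \<bar>(3 * \<alpha> + 2) / (2 * \<alpha>)\<bar> + \<bar>2 * (\<alpha> + 1) / \<alpha>\<bar> + \<bar>(\<alpha> + 2) / (2 * \<alpha>)\<bar>"
  have "norm (gen_poly \<alpha> z powr of_real \<alpha>) \<le> N powr \<alpha>" if z: "norm z \<le> 1" for z
  proof -
    have "norm (gen_poly \<alpha> z) \<le> norm (complex_of_real ((3 * \<alpha> + 2) / (2 * \<alpha>)))
       + norm (of_real (2 * (\<alpha> + 1) / \<alpha>) * z) + norm (of_real ((\<alpha> + 2) / (2 * \<alpha>)) * z\<^sup>2)"
      unfolding gen_poly_def by (intro order_trans[OF norm_triangle_ineq] add_mono
          order_trans[OF norm_triangle_ineq4] order_refl)
    also have "\<dots> \<le> N"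
      unfolding N_def norm_mult norm_power norm_of_real
      using z by (intro add_mono order_refl mult_left_le power_le_one) auto
    finally have "norm (gen_poly \<alpha> z) \<le> N" .
    thus ?thesis
      using assms by (subst norm_powr_real_powr') (auto intro!: powr_mono2)
  qed
  thus ?thesis by blast
qed

text \<open>
  Near \<open>0\<close> this is the third-order agreement of the two factors. Away from \<open>0\<close> the two symbols are
  separately bounded by a constant and by a constant times \<open>\<bar>\<theta>\<bar> powr \<alpha>\<close>, and both are dominated
  by \<open>\<bar>\<theta>\<bar> powr (\<alpha> + 3)\<close> there.
\<close>

lemma symbol_err_bound:
  assumes \<alpha>: "\<alpha> > 0"
  shows "\<exists>C. \<forall>\<theta>. norm (symbol_err \<alpha> \<theta>) \<le> C * \<bar>\<theta>\<bar> powr (\<alpha> + 3)"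
proof -
  define g where "g = (\<lambda>s. if s = 0 then 1 else gen_poly \<alpha> (exp (- s)) / s)"
  define \<Phi> where "\<Phi> = (\<lambda>s. exp (- s) * g s powr of_real \<alpha>
                - (1 + complex_of_real (sigma2 \<alpha>) * (exp s + exp (- s) - 2)))"
  obtain F where F: "\<Phi> has_fps_expansion F" "fps_nth F 0 = 0" "fps_nth F 1 = 0" "fps_nth F 2 = 0"
    using symbol_quotient_expansion(1)[OF \<alpha>] unfolding \<Phi>_def g_def by blast
  obtain C1 d1 where d1: "d1 > 0" "C1 \<ge> 0" and C1: "\<And>s. norm s < d1 \<Longrightarrow> norm (\<Phi> s) \<le> C1 * norm s ^ 3"
    using has_fps_expansion_bound_cubic[OF F] by blast
  have "\<forall>\<^sub>F s in nhds 0. Re (g s) > 0"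
    unfolding g_def by (rule symbol_quotient_expansion(2)[OF \<alpha>])
  then obtain d2 where d2: "d2 > 0" and g: "\<And>s. norm s < d2 \<Longrightarrow> Re (g s) > 0"
    unfolding eventually_nhds_metric by auto
  define d where "d = min d1 d2"
  have d: "d > 0" using d1 d2 by (simp add: d_def)
  obtain M where M: "\<And>z. norm z \<le> 1 \<Longrightarrow> norm (gen_poly \<alpha> z powr of_real \<alpha>) \<le> M"
    using gen_poly_bounded[OF \<alpha>] by blast
  have M0: "M \<ge> 0" by (rule order_trans[OF norm_ge_zero M[of 0]]) simp
  define C2 where "C2 = M / d powr (\<alpha> + 3) + (1 + \<bar>sigma2 \<alpha>\<bar> * 4) / d ^ 3"
  have C20: "C2 \<ge> 0" using M0 d by (auto simp: C2_def)
  have "norm (symbol_err \<alpha> \<theta>) \<le> (C1 + C2) * \<bar>\<theta>\<bar> powr (\<alpha> + 3)" for \<theta>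
  proof (cases "\<bar>\<theta>\<bar> < d")
    case True
    define s where "s = \<i> * complex_of_real \<theta>"
    have ns: "norm s = \<bar>\<theta>\<bar>" by (simp add: s_def norm_mult)
    have sg: "gen_poly \<alpha> (exp (- s)) = s * g s"
      by (cases "s = 0") (simp_all add: g_def gen_poly_1[OF \<alpha>])
    have cis: "cis (- \<theta>) = exp (- s)" "cis \<theta> = exp s"
      by (simp_all add: s_def cis_conv_exp)
    have "(s * g s) powr of_real \<alpha> = s powr of_real \<alpha> * g s powr of_real \<alpha>"
      unfolding s_def by (rule powr_mult_imaginary) (use g[of s] True ns in \<open>auto simp: d_def
          s_def\<close>)
    hence "symbol_err \<alpha> \<theta> = s powr of_real \<alpha> * \<Phi> s"
      unfolding symbol_err_def cis sg \<Phi>_def by (simp add: s_def algebra_simps)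
    hence "norm (symbol_err \<alpha> \<theta>) = \<bar>\<theta>\<bar> powr \<alpha> * norm (\<Phi> s)"
      by (simp add: norm_mult s_def norm_i_powr)
    also have "\<dots> \<le> \<bar>\<theta>\<bar> powr \<alpha> * (C1 * \<bar>\<theta>\<bar> ^ 3)"
      using C1[of s] True by (intro mult_left_mono) (auto simp: ns d_def)
    also have "\<dots> = C1 * \<bar>\<theta>\<bar> powr (\<alpha> + 3)"
      by (cases "\<theta> = 0") (auto simp: powr_add)
    also have "\<dots> \<le> (C1 + C2) * \<bar>\<theta>\<bar> powr (\<alpha> + 3)"
      using C20 by (intro mult_right_mono) auto
    finally show ?thesis .
  next
    case False
    hence \<theta>: "\<bar>\<theta>\<bar> \<ge> d" "\<bar>\<theta>\<bar> > 0" using d by auto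
    have "norm (cis \<theta> + cis (- \<theta>) - 2) \<le> (norm (cis \<theta>) + norm (cis (- \<theta>))) + norm (2::complex)"
      by (intro order_trans[OF norm_triangle_ineq4] add_mono norm_triangle_ineq order_refl)
    hence n4: "norm (cis \<theta> + cis (- \<theta>) - 2) \<le> 4" by simp
    have "norm (1 + of_real (sigma2 \<alpha>) * (cis \<theta> + cis (- \<theta>) - 2))
        \<le> norm (1::complex) + norm (of_real (sigma2 \<alpha>) * (cis \<theta> + cis (- \<theta>) - 2))"
      by (rule norm_triangle_ineq)
    also have "\<dots> \<le> 1 + \<bar>sigma2 \<alpha>\<bar> * 4"
      using n4 by (auto simp: norm_mult intro!: mult_left_mono)
    finally have n5: "norm (1 + of_real (sigma2 \<alpha>) * (cis \<theta> + cis (- \<theta>) - 2))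
        \<le> 1 + \<bar>sigma2 \<alpha>\<bar> * 4" .
    have "norm (symbol_err \<alpha> \<theta>) \<le> norm (gen_poly \<alpha> (cis (- \<theta>)) powr of_real \<alpha>)
        + \<bar>\<theta>\<bar> powr \<alpha> * norm (1 + of_real (sigma2 \<alpha>) * (cis \<theta> + cis (- \<theta>) - 2))"
      unfolding symbol_err_def
      by (rule order_trans[OF norm_triangle_ineq4]) (simp add: norm_mult norm_i_powr)
    also have "\<dots> \<le> M + \<bar>\<theta>\<bar> powr \<alpha> * (1 + \<bar>sigma2 \<alpha>\<bar> * 4)"
      using n5 by (intro add_mono M mult_left_mono) auto
    also have "\<dots> \<le> M * (\<bar>\<theta>\<bar> powr (\<alpha> + 3) / d powr (\<alpha> + 3)) + \<bar>\<theta>\<bar> powr \<alpha> * (1 + \<bar>sigma2 \<alpha>\<bar> * 4)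
        * (\<bar>\<theta>\<bar> ^ 3 / d ^ 3)"
    proof (intro add_mono)
      have "d powr (\<alpha> + 3) \<le> \<bar>\<theta>\<bar> powr (\<alpha> + 3)"
        using \<theta> d \<alpha> by (intro powr_mono2) auto
      thus "M \<le> M * (\<bar>\<theta>\<bar> powr (\<alpha> + 3) / d powr (\<alpha> + 3))"
        using M0 d by (simp add: mult_left_mono field_simps)
      have "d ^ 3 \<le> \<bar>\<theta>\<bar> ^ 3" using \<theta> d by (intro power_mono) auto
      hence "1 \<le> \<bar>\<theta>\<bar> ^ 3 / d ^ 3" using d by simp
      hence "\<bar>\<theta>\<bar> powr \<alpha> * (1 + \<bar>sigma2 \<alpha>\<bar> * 4) * 1
          \<le> \<bar>\<theta>\<bar> powr \<alpha> * (1 + \<bar>sigma2 \<alpha>\<bar> * 4) * (\<bar>\<theta>\<bar> ^ 3 / d ^ 3)"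
        by (intro mult_left_mono) auto
      thus "\<bar>\<theta>\<bar> powr \<alpha> * (1 + \<bar>sigma2 \<alpha>\<bar> * 4)
          \<le> \<bar>\<theta>\<bar> powr \<alpha> * (1 + \<bar>sigma2 \<alpha>\<bar> * 4) * (\<bar>\<theta>\<bar> ^ 3 / d ^ 3)"
        by simp
    qed
    also have "\<dots> = C2 * \<bar>\<theta>\<bar> powr (\<alpha> + 3)"
      using \<theta> by (simp add: C2_def powr_add field_simps)
    also have "\<dots> \<le> (C1 + C2) * \<bar>\<theta>\<bar> powr (\<alpha> + 3)"
      using d1 by (intro mult_right_mono) auto
    finally show ?thesis .
  qed
  thus ?thesis by blast
qed

section \<open>Fourier transform and inversion\<close>

lemma cis_borel_measurable [measurable]: "cis \<in> borel_measurable borel"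
  by (intro borel_measurable_continuous_onI continuous_intros)

lemma tendsto_integral_dominated_within:
  fixes s :: "real \<Rightarrow> real \<Rightarrow> complex" and w :: "real \<Rightarrow> real"
  assumes [measurable]: "f \<in> borel_measurable lborel" "\<And>t. s t \<in> borel_measurable lborel"
    and w: "integrable lborel w"
    and lim: "AE x in lborel. ((\<lambda>t. s t x) \<longlongrightarrow> f x) (at a within S)"
    and bound: "\<And>t. t \<in> S \<Longrightarrow> t \<noteq> a \<Longrightarrow> AE x in lborel. norm (s t x) \<le> w x"
  shows "((\<lambda>t. LINT x|lborel. s t x) \<longlongrightarrow> (LINT x|lborel. f x)) (at a within S)"
  unfolding tendsto_at_iff_sequentially o_def
proof (intro allI impI)
  fix X :: "nat \<Rightarrow> real" assume X: "\<forall>i. X i \<in> S - {a}" "X \<longlonglongrightarrow> a"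
  show "(\<lambda>i. LINT x|lborel. s (X i) x) \<longlonglongrightarrow> (LINT x|lborel. f x)"
  proof (rule integral_dominated_convergence[OF _ _ w])
    show "AE x in lborel. (\<lambda>i. s (X i) x) \<longlonglongrightarrow> f x"
      using lim X by (auto simp: tendsto_at_iff_sequentially o_def elim!: eventually_mono)
    show "AE x in lborel. norm (s (X i) x) \<le> w x" for i
      using X bound by auto
  qed auto
qed

lemma integrable_pair_dominated:
  fixes g :: "real \<times> real \<Rightarrow> complex" and a b :: "real \<Rightarrow> real"
  assumes [measurable]: "g \<in> borel_measurable (lborel \<Otimes>\<^sub>M lborel)"
    and a: "integrable lborel a" and b: "integrable lborel b"
    and bd: "\<And>x y. norm (g (x, y)) \<le> a x * b y"
  shows "integrable (lborel \<Otimes>\<^sub>M lborel) g"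
proof (rule lborel_pair.Fubini_integrable)
  have int: "integrable lborel (\<lambda>y. g (x, y))" for x
    by (rule Bochner_Integration.integrable_bound[OF integrable_mult_right[OF b, of "a x"]])
       (use bd in \<open>auto intro: order_trans[OF bd abs_ge_self]\<close>)
  thus "AE x in lborel. integrable lborel (\<lambda>y. g (x, y))" by simp
  show "integrable lborel (\<lambda>x. LINT y|lborel. norm (g (x, y)))"
  proof (rule Bochner_Integration.integrable_bound[OF integrable_mult_left[OF a, of "LINT
      y|lborel. b y"]])
    show "AE x in lborel. norm (LINT y|lborel. norm (g (x, y))) \<le> norm (a x * (LINT y|lborel. b y))"
    proof (intro AE_I2)
      fix x
      have "(LINT y|lborel. norm (g (x, y))) \<le> (LINT y|lborel. a x * b y)"
        by (intro integral_mono integrable_norm int integrable_mult_right b bd)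
      also have "\<dots> = a x * (LINT y|lborel. b y)" by simp
      finally show "norm (LINT y|lborel. norm (g (x, y))) \<le> norm (a x * (LINT y|lborel. b y))"
        by (simp add: integral_nonneg_AE)
    qed
  qed measurable
qed measurable

text \<open>
  The Fourier transform of a real function, with the kernel \<open>exp (- \<i>\<xi>x)\<close> and no normalising
  constant. The value is meaningful when \<open>f\<close> is integrable.
\<close>

definition fourier :: "(real \<Rightarrow> real) \<Rightarrow> real \<Rightarrow> complex" where
  "fourier f \<xi> = (LINT x|lborel. of_real (f x) * cis (- (\<xi> * x)))"

text \<open>
  The inverse transform without the factor \<open>1 / (2 * pi)\<close>, which appears explicitly in the
  inversion formula.
\<close>

definition inv_fourier :: "(real \<Rightarrow> complex) \<Rightarrow> real \<Rightarrow> complex" where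
  "inv_fourier F x = (LINT \<xi>|lborel. F \<xi> * cis (\<xi> * x))"

lemma integrable_mult_cis:
  fixes F :: "real \<Rightarrow> complex"
  assumes "integrable lborel F" "g \<in> borel_measurable borel"
  shows "integrable lborel (\<lambda>x. F x * cis (g x))"
  by (rule Bochner_Integration.integrable_bound[OF assms(1)])
     (use assms in \<open>auto simp: norm_mult\<close>)

lemma borel_measurable_fourier [measurable]:
  assumes [measurable]: "f \<in> borel_measurable borel"
  shows "fourier f \<in> borel_measurable borel"
  unfolding fourier_def by measurable

lemma norm_fourier_le:
  shows "norm (fourier f \<xi>) \<le> (LINT x|lborel. \<bar>f x\<bar>)"
  unfolding fourier_def
  by (rule order_trans[OF integral_norm_bound]) (simp add: norm_mult)

lemma fourier_gaussian:
  "(LINT \<xi>|lborel. of_real (exp (- \<xi>\<^sup>2 / 2)) * cis (\<xi> * t))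
      = of_real (sqrt (2 * pi) * exp (- t\<^sup>2 / 2))"
proof -
  have "char std_normal_distribution t
      = (LINT \<xi>|lborel. std_normal_density \<xi> *\<^sub>R cis (t * \<xi>))"
    unfolding char_def
    by (subst integral_density) (auto simp: cis_conv_exp normal_density_nonneg)
  also have "\<dots> = (LINT \<xi>|lborel. of_real (1 / sqrt (2 * pi)) * (of_real (exp (- \<xi>\<^sup>2 / 2))
      * cis (\<xi> * t)))"
    by (intro Bochner_Integration.integral_cong refl)
       (simp add: std_normal_density_def scaleR_conv_of_real mult.commute)
  also have "\<dots> = of_real (1 / sqrt (2 * pi)) * (LINT \<xi>|lborel. of_real (exp (- \<xi>\<^sup>2 / 2))
      * cis (\<xi> * t))"
    by (rule integral_mult_right_zero)
  finally have "of_real (1 / sqrt (2 * pi)) * (LINT \<xi>|lborel. of_real (exp (- \<xi>\<^sup>2 / 2)) * cis (\<xi>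
      * t)) = complex_of_real (exp (- t\<^sup>2 / 2))"
    by (simp add: char_std_normal_distribution)
  hence "of_real (sqrt (2 * pi)) * (of_real (1 / sqrt (2 * pi))
      * (LINT \<xi>|lborel. of_real (exp (- \<xi>\<^sup>2 / 2)) * cis (\<xi> * t)))
          = of_real (sqrt (2 * pi)) * complex_of_real (exp (- t\<^sup>2 / 2))"
    by simp
  thus ?thesis by simp
qed

lemma integrable_gaussian: "integrable lborel (\<lambda>x::real. exp (- x\<^sup>2 / 2))"
proof -
  have "integrable lborel (\<lambda>x. sqrt (2 * pi) * std_normal_density x)"
    by (intro integrable_mult_right integrable_normal_density) simp
  thus ?thesis by (simp add: std_normal_density_def)
qed

lemma integral_gaussian: "(LINT x|lborel. exp (- x\<^sup>2 / 2)) = sqrt (2 * pi)"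
proof -
  have "(LINT x|lborel. sqrt (2 * pi) * std_normal_density x) = sqrt (2 * pi)"
    by (subst integral_mult_right_zero) (simp add: integral_normal_density)
  thus ?thesis by (simp add: std_normal_density_def)
qed

text \<open>
  A Gaussian factor is inserted into the inversion integral. By Fubini's theorem the result is the
  convolution of \<open>f\<close> with a Gaussian of width \<open>\<epsilon>\<close>, and \<open>\<epsilon>\<close> tends to \<open>0\<close> on both sides.
\<close>

lemma fourier_inversion:
  assumes f: "integrable lborel f" and F: "integrable lborel (fourier f)"
    and cont: "continuous_on UNIV f" and bd: "\<And>x. \<bar>f x\<bar> \<le> B"
  shows "inv_fourier (fourier f) x = of_real (2 * pi * f x)"
proof -
  have [measurable]: "f \<in> borel_measurable borel" using f by auto
  define G where "G = (\<lambda>\<epsilon>. LINT \<xi>|lborel. fourier f \<xi> * cis (\<xi> * x) * of_real (exp (- (\<epsilon> * \<xi>)\<^sup>2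
      / 2)))"
  have G1: "(G \<longlongrightarrow> inv_fourier (fourier f) x) (at_right 0)"
    unfolding G_def inv_fourier_def
  proof (rule tendsto_integral_dominated_within[where w = "\<lambda>\<xi>. norm (fourier f \<xi>)"])
    show "AE \<xi> in lborel. ((\<lambda>\<epsilon>. fourier f \<xi> * cis (\<xi> * x) * of_real (exp (- (\<epsilon> * \<xi>)\<^sup>2 / 2)))
        \<longlongrightarrow> fourier f \<xi> * cis (\<xi> * x)) (at_right 0)"
      by (intro AE_I2) (auto intro!: tendsto_eq_intros)
    show "AE \<xi> in lborel. norm (fourier f \<xi> * cis (\<xi> * x) * of_real (exp (- (\<epsilon> * \<xi>)\<^sup>2 / 2)))
        \<le> norm (fourier f \<xi>)" for \<epsilon>
      by (intro AE_I2) (auto simp: norm_mult intro!: mult_left_le)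
  qed (use F in auto)
  have G2: "G \<epsilon> = (LINT w|lborel. of_real (f (x - \<epsilon> * w)) * of_real (sqrt (2 * pi) * exp (- w\<^sup>2
      / 2)))"
    if \<epsilon>: "\<epsilon> > 0" for \<epsilon>
  proof -
    let ?g = "\<lambda>y \<xi>. of_real (f y) * cis (- (\<xi> * y)) * (cis (\<xi> * x) * complex_of_real (exp (- (\<epsilon>
        * \<xi>)\<^sup>2 / 2)))"
    have e1: "integrable lborel (\<lambda>\<xi>. exp (- (\<epsilon> * \<xi>)\<^sup>2 / 2))"
      using lborel_integrable_real_affine[OF integrable_gaussian, of \<epsilon> 0] \<epsilon> by simp
    have int: "integrable (lborel \<Otimes>\<^sub>M lborel) (case_prod ?g)"
      by (rule integrable_pair_dominated[OF _ integrable_norm[OF f] e1])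
         (auto simp: norm_mult)
    have "G \<epsilon> = (LINT \<xi>|lborel. LINT y|lborel. ?g y \<xi>)"
      unfolding G_def fourier_def by (simp add: mult.assoc[symmetric])
    also have "\<dots> = (LINT y|lborel. LINT \<xi>|lborel. ?g y \<xi>)"
      by (rule lborel_pair.Fubini_integral[OF int])
    also have "\<dots> = (LINT y|lborel. of_real (f y) * of_real (sqrt (2 * pi) * exp (- ((x - y)
        / \<epsilon>)\<^sup>2 / 2) / \<epsilon>))"
    proof (intro Bochner_Integration.integral_cong refl)
      fix y
      have c: "cis (\<xi> * (x - y)) = cis (- (\<xi> * y)) * cis (\<xi> * x)" for \<xi>
        by (simp add: cis_mult algebra_simps)
      have "(LINT \<xi>|lborel. ?g y \<xi>) = of_real (f y) * (LINT \<xi>|lborel. complex_of_real (exp (- (\<epsilon>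
          * \<xi>)\<^sup>2 / 2)) * cis (\<xi> * (x - y)))"
        by (subst integral_mult_right_zero[symmetric], intro Bochner_Integration.integral_cong refl)
           (simp add: c mult_ac)
      also have "(LINT \<xi>|lborel. complex_of_real (exp (- (\<epsilon> * \<xi>)\<^sup>2 / 2)) * cis (\<xi> * (x - y)))
         = (1 / \<epsilon>) *\<^sub>R (LINT \<eta>|lborel. complex_of_real (exp (- \<eta>\<^sup>2 / 2)) * cis (\<eta> * ((x - y) / \<epsilon>)))"
        using \<epsilon> by (subst lborel_integral_real_affine[where c = "1 / \<epsilon>" and t
            = 0]) (auto simp: field_simps)
      also have "\<dots> = of_real (sqrt (2 * pi) * exp (- ((x - y) / \<epsilon>)\<^sup>2 / 2) / \<epsilon>)"
        by (subst fourier_gaussian) (simp add: scaleR_conv_of_real)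
      finally show "(LINT \<xi>|lborel. ?g y \<xi>) = of_real (f y) * of_real (sqrt (2 * pi)
          * exp (- ((x - y) / \<epsilon>)\<^sup>2 / 2) / \<epsilon>)" .
    qed
    \<comment> \<open>The substitution \<open>y = x - \<epsilon> w\<close>.\<close>
    also have "\<dots> = (LINT w|lborel. of_real (f (x - \<epsilon> * w)) * of_real (sqrt (2 * pi) * exp (- w\<^sup>2
        / 2)))"
      using \<epsilon> by (subst lborel_integral_real_affine[where c = "-\<epsilon>" and t = x])
        (auto simp: scaleR_conv_of_real)
    finally show ?thesis .
  qed
  have lim: "((\<lambda>\<epsilon>. LINT w|lborel. of_real (f (x - \<epsilon> * w)) * of_real (sqrt (2 * pi) * exp (- w\<^sup>2
      / 2)))
     \<longlongrightarrow> (LINT w|lborel. of_real (f x) * complex_of_real (sqrt (2 * pi) * exp (- w\<^sup>2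
         / 2)))) (at_right 0)"
  proof (rule tendsto_integral_dominated_within[where w
      = "\<lambda>w. B * (sqrt (2 * pi) * exp (- w\<^sup>2 / 2))"])
    show "integrable lborel (\<lambda>w. B * (sqrt (2 * pi) * exp (- w\<^sup>2 / 2)))"
      by (intro integrable_mult_right integrable_gaussian)
    have "((\<lambda>\<epsilon>. f (x - \<epsilon> * w)) \<longlongrightarrow> f (x - 0 * w)) (at_right 0)" for w
      by (rule isCont_tendsto_compose[of _ f])
         (use cont in \<open>auto simp: continuous_on_eq_continuous_at intro!: tendsto_eq_intros\<close>)
    thus "AE w in lborel. ((\<lambda>\<epsilon>. of_real (f (x - \<epsilon> * w)) * complex_of_real (sqrt (2 * pi)
        * exp (- w\<^sup>2 / 2)))
      \<longlongrightarrow> of_real (f x) * complex_of_real (sqrt (2 * pi) * exp (- w\<^sup>2 / 2))) (at_right 0)"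
      by (intro AE_I2 tendsto_intros) simp
    show "AE w in lborel. norm (of_real (f (x - \<epsilon> * w)) * complex_of_real (sqrt (2 * pi)
        * exp (- w\<^sup>2 / 2))) \<le> B * (sqrt (2 * pi) * exp (- w\<^sup>2 / 2))" for \<epsilon>
      by (intro AE_I2) (simp add: norm_mult bd mult_right_mono)
  qed auto
  have I: "(LINT w|lborel. of_real (f x) * complex_of_real (sqrt (2 * pi) * exp (- w\<^sup>2 / 2)))
      = of_real (2 * pi * f x)"
    by (simp only: of_real_mult[symmetric] integral_complex_of_real integral_mult_right_zero
        integral_gaussian)
       (simp add: mult_ac)
  have "(G \<longlongrightarrow> of_real (2 * pi * f x)) (at_right 0)"
    by (rule Lim_transform_eventually[OF lim[unfolded I]])
       (intro eventually_mono[OF eventually_at_right_less[of 0]], simp add: G2)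
  with G1 show ?thesis
    using tendsto_unique trivial_limit_at_right_real by blast
qed

lemma inv_fourier_has_vector_derivative:
  fixes F :: "real \<Rightarrow> complex"
  assumes F: "integrable lborel F" and F1: "integrable lborel (\<lambda>\<xi>. of_real \<xi> * F \<xi>)"
  shows "(inv_fourier F has_vector_derivative inv_fourier (\<lambda>\<xi>. \<i> * of_real \<xi> * F \<xi>) y) (at y)"
proof -
  have [measurable]: "F \<in> borel_measurable borel" using F by auto
  have lim: "((\<lambda>h. LINT \<xi>|lborel. F \<xi> * ((cis (\<xi> * (y + h)) - cis (\<xi> * y)) / of_real h))
     \<longlongrightarrow> (LINT \<xi>|lborel. F \<xi> * (\<i> * of_real \<xi> * cis (\<xi> * y)))) (at 0)"
  proof (rule tendsto_integral_dominated_within[where w = "\<lambda>\<xi>. norm (of_real \<xi> * F \<xi>)"])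
    show "AE \<xi> in lborel. ((\<lambda>h. F \<xi> * ((cis (\<xi> * (y + h)) - cis (\<xi> * y)) / of_real h))
        \<longlongrightarrow> F \<xi> * (\<i> * of_real \<xi> * cis (\<xi> * y))) (at 0)"
    proof (intro AE_I2 tendsto_mult tendsto_const)
      fix \<xi> :: real
      have "((\<lambda>z. exp (\<i> * of_real \<xi> * z)) has_field_derivative \<i> * of_real \<xi> * cis (\<xi>
          * y)) (at (of_real y))"
        by (auto intro!: derivative_eq_intros simp: cis_conv_exp mult_ac)
      hence "((\<lambda>h. (exp (\<i> * of_real \<xi> * (of_real y + h)) - exp (\<i> * of_real \<xi> * of_real y))
          / h) \<longlongrightarrow> \<i> * of_real \<xi> * cis (\<xi> * y)) (at 0)"
        by (simp add: DERIV_def)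
      moreover have "filterlim complex_of_real (at 0) (at 0)"
        by (rule filterlim_atI) (auto intro!: tendsto_eq_intros eventually_at_filter[THEN iffD2])
      ultimately have "((\<lambda>h. (exp (\<i> * of_real \<xi> * (of_real y + of_real h)) - exp (\<i> * of_real \<xi>
          * of_real y)) / of_real h) \<longlongrightarrow> \<i> * of_real \<xi> * cis (\<xi> * y)) (at (0::real))"
        by (rule filterlim_compose)
      thus "((\<lambda>h. (cis (\<xi> * (y + h)) - cis (\<xi> * y)) / of_real h)
          \<longlongrightarrow> \<i> * of_real \<xi> * cis (\<xi> * y)) (at 0)"
        by (simp add: cis_conv_exp mult_ac)
    qed
    show "AE \<xi> in lborel. norm (F \<xi> * ((cis (\<xi> * (y + h)) - cis (\<xi> * y)) / of_real h))
        \<le> norm (of_real \<xi> * F \<xi>)"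
      if "h \<noteq> 0" for h
    proof (intro AE_I2)
      fix \<xi>
      have "cis (\<xi> * (y + h)) - cis (\<xi> * y) = cis (\<xi> * y) * (cis (\<xi> * h) - 1)"
        by (simp add: algebra_simps cis_mult)
      moreover have "norm (cis (\<xi> * h) - 1) \<le> \<bar>\<xi> * h\<bar>"
        using iexp_approx1[of "\<xi> * h" 0] by (simp add: cis_conv_exp)
      ultimately have "norm (cis (\<xi> * (y + h)) - cis (\<xi> * y)) / \<bar>h\<bar> \<le> \<bar>\<xi>\<bar>"
        using that by (simp add: norm_mult abs_mult divide_le_eq)
      hence "norm (F \<xi>) * (norm (cis (\<xi> * (y + h)) - cis (\<xi> * y)) / \<bar>h\<bar>) \<le> norm (F \<xi>) * \<bar>\<xi>\<bar>"
        by (intro mult_left_mono) auto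
      thus "norm (F \<xi> * ((cis (\<xi> * (y + h)) - cis (\<xi> * y)) / of_real h)) \<le> norm (of_real \<xi> * F \<xi>)"
        by (simp add: norm_mult norm_divide mult_ac)
    qed
  qed (use F1 in auto)
  have quot: "(LINT \<xi>|lborel. F \<xi> * ((cis (\<xi> * (y + h)) - cis (\<xi> * y)) / of_real h))
      = (inv_fourier F (y + h) - inv_fourier F y) / of_real h" for h
  proof -
    have "(LINT \<xi>|lborel. F \<xi> * ((cis (\<xi> * (y + h)) - cis (\<xi> * y)) / of_real h))
       = (LINT \<xi>|lborel. (F \<xi> * cis (\<xi> * (y + h)) - F \<xi> * cis (\<xi> * y)) / of_real h)"
      by (simp add: algebra_simps diff_divide_distrib)
    also have "\<dots> = (inv_fourier F (y + h) - inv_fourier F y) / of_real h"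
      unfolding inv_fourier_def
      by (subst integral_divide_zero, subst Bochner_Integration.integral_diff)
         (auto intro!: integrable_mult_cis F)
    finally show ?thesis .
  qed
  define D where "D = inv_fourier (\<lambda>\<xi>. \<i> * of_real \<xi> * F \<xi>) y"
  have "((\<lambda>h. (inv_fourier F (y + h) - inv_fourier F y) / of_real h) \<longlongrightarrow> D) (at 0)"
  proof -
    have "D = (LINT \<xi>|lborel. F \<xi> * (\<i> * of_real \<xi> * cis (\<xi> * y)))"
      unfolding D_def inv_fourier_def by (simp add: mult_ac)
    thus ?thesis using lim unfolding quot by simp
  qed
  hence "((\<lambda>h. norm ((inv_fourier F (y + h) - inv_fourier F y) / of_real h - D)) \<longlongrightarrow> 0) (at 0)"
    by (simp add: tendsto_norm_zero_iff LIM_zero_iff)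
  also have "?this \<longleftrightarrow> ((\<lambda>h. norm (inv_fourier F (y + h) - inv_fourier F y - h *\<^sub>R D) / norm h)
      \<longlongrightarrow> 0) (at 0)"
  proof (rule tendsto_cong, unfold eventually_at_filter, intro always_eventually allI impI)
    fix h :: real assume "h \<noteq> 0"
    hence "(inv_fourier F (y + h) - inv_fourier F y) / of_real h - D
        = (inv_fourier F (y + h) - inv_fourier F y - h *\<^sub>R D) / of_real h"
      by (simp add: field_simps scaleR_conv_of_real)
    thus "norm ((inv_fourier F (y + h) - inv_fourier F y) / of_real h - D)
        = norm (inv_fourier F (y + h) - inv_fourier F y - h *\<^sub>R D) / norm h"
      by (simp add: norm_divide)
  qed
  finally show ?thesis
    unfolding has_vector_derivative_def has_derivative_at D_def[symmetric]
    by (auto intro: bounded_linear_intros)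
qed

section \<open>Transform of the damped power kernel\<close>

lemma has_bochner_integral_lborel_of_has_integral:
  fixes f :: "real \<Rightarrow> real"
  assumes [measurable]: "f \<in> borel_measurable borel" and nn: "\<And>x. 0 \<le> f x"
    and I: "(f has_integral I) UNIV"
  shows "has_bochner_integral lborel f I"
proof (rule has_bochner_integral_nn_integral)
  show "0 \<le> I" by (rule has_integral_nonneg[OF I]) (use nn in auto)
  show "(\<integral>\<^sup>+ x. ennreal (f x) \<partial>lborel) = ennreal I"
    by (rule nn_integral_has_integral_lborel[OF _ nn I]) auto
qed (use nn in auto)

text \<open>
  The kernel \<open>r powr (a - 1)\<close> of the fractional integral of order \<open>a\<close> on the positive half-line
  (without the factor \<open>1 / Gamma a\<close>), damped by \<open>exp (- \<epsilon> r)\<close>. The undamped kernel, \<open>\<epsilon> = 0\<close>, is not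
  integrable, which is why the damping is needed before Fubini's theorem can be used.
\<close>

definition gamma_kernel :: "real \<Rightarrow> real \<Rightarrow> real \<Rightarrow> real" where
  "gamma_kernel a \<epsilon> r = indicator {0<..} r * (r powr (a - 1) * exp (- (\<epsilon> * r)))"

lemma borel_measurable_gamma_kernel [measurable]: "gamma_kernel a \<epsilon> \<in> borel_measurable borel"
  unfolding gamma_kernel_def by measurable

lemma has_bochner_integral_gamma_kernel:
  assumes a: "a > 0" and \<epsilon>: "\<epsilon> > 0"
  shows "has_bochner_integral lborel (gamma_kernel a \<epsilon>) (Gamma a * \<epsilon> powr (- a))"
proof -
  have "((\<lambda>t. if t \<in> {0..} then t powr (a - 1) / exp t else 0) has_integral Gamma a) UNIV"
    by (subst has_integral_restrict_UNIV) (rule Gamma_integral_real[OF a])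
  hence "(gamma_kernel a 1 has_integral Gamma a) UNIV"
    by (rule has_integral_spike[of "{0}", rotated 2])
       (auto simp: gamma_kernel_def exp_minus field_simps)
  hence 1: "has_bochner_integral lborel (gamma_kernel a 1) (Gamma a)"
    by (intro has_bochner_integral_lborel_of_has_integral) (auto simp: gamma_kernel_def)
  have eq: "gamma_kernel a 1 (0 + \<epsilon> * r) = \<epsilon> powr (a - 1) * gamma_kernel a \<epsilon> r" for r
    using \<epsilon> by (auto simp: gamma_kernel_def powr_mult indicator_def zero_less_mult_iff)
  have "integrable lborel (\<lambda>r. gamma_kernel a 1 (0 + \<epsilon> * r))"
    using 1 \<epsilon> by (intro lborel_integrable_real_affine) (auto simp: has_bochner_integral_iff)
  hence int: "integrable lborel (gamma_kernel a \<epsilon>)"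
    unfolding eq using \<epsilon> by simp
  have "Gamma a = (LINT r|lborel. gamma_kernel a 1 r)"
    using 1 by (simp add: has_bochner_integral_iff)
  also have "\<dots> = \<epsilon> * (LINT r|lborel. gamma_kernel a 1 (0 + \<epsilon> * r))"
    using \<epsilon> by (subst lborel_integral_real_affine[where c = \<epsilon> and t = 0]) auto
  also have "\<dots> = \<epsilon> powr a * (LINT r|lborel. gamma_kernel a \<epsilon> r)"
    unfolding eq using \<epsilon> by (simp add: powr_diff)
  finally have "(LINT r|lborel. gamma_kernel a \<epsilon> r) = Gamma a * \<epsilon> powr (- a)"
    using \<epsilon> by (simp add: powr_minus field_simps)
  thus ?thesis using int by (simp add: has_bochner_integral_iff)
qed

lemma integrable_gamma_kernel:
  assumes "a > 0" and "\<epsilon> > 0"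
  shows "integrable lborel (gamma_kernel a \<epsilon>)"
  using has_bochner_integral_gamma_kernel[OF assms] by (simp add: has_bochner_integral_iff)

text \<open>
  Integration by parts of \<open>r powr a * exp (- (\<epsilon> + \<i>\<xi>) r)\<close> over the half-line.
\<close>

lemma fourier_gamma_kernel_recurrence:
  assumes a: "a > 0" and \<epsilon>: "\<epsilon> > 0"
  shows "(of_real \<epsilon> + \<i> * of_real \<xi>) * fourier (gamma_kernel (a + 1) \<epsilon>) \<xi>
      = of_real a * fourier (gamma_kernel a \<epsilon>) \<xi>"
proof -
  define s where "s = of_real \<epsilon> + \<i> * complex_of_real \<xi>"
  define e where "e = (\<lambda>r. exp (- s * complex_of_real r))"
  define F where "F = (\<lambda>r. of_real (r powr a) * e r)"
  define f where "f = (\<lambda>r. of_real (a * r powr (a - 1)) * e r - s * (of_real (r powr a) * e r))"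
  have e: "e r = of_real (exp (- (\<epsilon> * r))) * cis (- (\<xi> * r))" for r
    unfolding e_def s_def cis_conv_exp
    by (simp add: exp_of_real[symmetric] ring_distribs mult_ac flip: exp_add)
  have k: "indicator {0<..} r *\<^sub>R f r = of_real a * (of_real (gamma_kernel a \<epsilon> r) * cis (- (\<xi> * r)))
      - s * (of_real (gamma_kernel (a + 1) \<epsilon> r) * cis (- (\<xi> * r)))" for r
    by (auto simp: f_def gamma_kernel_def e indicator_def algebra_simps)
  have i1: "integrable lborel (\<lambda>r. complex_of_real (gamma_kernel a \<epsilon> r) * cis (- (\<xi> * r)))"
    and i2: "integrable lborel (\<lambda>r. complex_of_real (gamma_kernel (a + 1) \<epsilon> r) * cis (- (\<xi> * r)))"
    using a \<epsilon> by (intro integrable_mult_cis integrable_of_real integrable_gamma_kernel; simp)+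
  have L: "(LINT r|lborel. indicator {0<..} r *\<^sub>R f r)
      = of_real a * fourier (gamma_kernel a \<epsilon>) \<xi> - s * fourier (gamma_kernel (a + 1) \<epsilon>) \<xi>"
    unfolding k fourier_def by (subst Bochner_Integration.integral_diff) (use i1 i2 in auto)
  have "(LBINT r=0..\<infinity>. f r) = 0 - 0"
  proof (rule interval_integral_FTC_integrable[where F = F])
    show "(F has_vector_derivative f r) (at r)" if "0 < ereal r" for r
    proof -
      have r: "r > 0" using that by simp
      have "(e has_vector_derivative (- s * e r)) (at r)"
        unfolding e_def
        by (rule has_vector_derivative_real_field) (auto intro!: derivative_eq_intros)
      moreover have "((\<lambda>r. of_real (r powr a))
          has_vector_derivative complex_of_real (a * r powr (a - 1))) (at r)"
        using r by (intro has_vector_derivative_of_real) (auto intro!: derivative_eq_intros simp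
            flip: has_real_derivative_iff_has_vector_derivative)
      ultimately show ?thesis
        unfolding F_def f_def
        by (intro has_vector_derivative_eq_rhs[OF has_vector_derivative_mult])
            (auto simp: algebra_simps)
    qed
    show "isCont f r" if "0 < ereal r" for r
      using that unfolding f_def e_def by (auto intro!: continuous_intros)
    have "integrable lborel (\<lambda>r. indicator {0<..} r *\<^sub>R f r)"
      unfolding k using i1 i2 by (intro Bochner_Integration.integrable_diff integrable_mult_right)
    thus "set_integrable lborel (einterval 0 \<infinity>) f"
      by (simp add: set_integrable_def einterval_def greaterThan_def flip: zero_ereal_def)
    have nF: "norm (F r) = r powr a * exp (- (\<epsilon> * r))" for r
      by (simp add: F_def e norm_mult)
    have "((\<lambda>r. norm (F r)) \<longlongrightarrow> 0) (at_right 0)"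
      unfolding nF using a by (auto intro!: tendsto_eq_intros eventually_mono[OF
          eventually_at_right_less[of 0]])
    hence "(F \<longlongrightarrow> 0) (at_right 0)" by (simp add: tendsto_norm_zero_iff)
    thus "((F \<circ> real_of_ereal) \<longlongrightarrow> 0) (at_right 0)"
      by (simp add: zero_ereal_def ereal_tendsto_simps1)
    have "((\<lambda>r. r powr a * exp (- (\<epsilon> * r))) \<longlongrightarrow> 0) at_top"
      using a \<epsilon> by real_asymp
    hence "((\<lambda>r. norm (F r)) \<longlongrightarrow> 0) at_top" unfolding nF .
    hence "(F \<longlongrightarrow> 0) at_top" by (simp add: tendsto_norm_zero_iff)
    thus "((F \<circ> real_of_ereal) \<longlongrightarrow> 0) (at_left \<infinity>)"
      by (simp add: ereal_tendsto_simps1)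
  qed auto
  hence "(LINT r|lborel. indicator {0<..} r *\<^sub>R f r) = 0"
    by (simp add: interval_lebesgue_integral_0_infty set_lebesgue_integral_def)
  thus ?thesis unfolding L s_def by simp
qed

text \<open>
  As a function of \<open>\<xi>\<close>, the transform times \<open>(\<epsilon> + \<i>\<xi>) powr a\<close> has derivative \<open>0\<close>
      by the recurrence, so it
  is equal to its value at \<open>\<xi> = 0\<close>, which is the real Gamma integral.
\<close>

lemma fourier_gamma_kernel:
  assumes a: "a > 0" and \<epsilon>: "\<epsilon> > 0"
  shows "fourier (gamma_kernel a \<epsilon>) \<xi> = of_real (Gamma a) * (of_real \<epsilon> + \<i>
      * of_real \<xi>) powr (- of_real a)"
proof -
  define w where "w = (\<lambda>\<xi>. of_real \<epsilon> + \<i> * complex_of_real \<xi>)"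
  have w: "w x \<notin> \<real>\<^sub>\<le>\<^sub>0" "w x \<noteq> 0" for x
    using \<epsilon> by (auto simp: w_def complex_nonpos_Reals_iff complex_eq_iff)
  define K where "K = (\<lambda>\<xi>. complex_of_real (gamma_kernel a \<epsilon> \<xi>))"
  have K: "integrable lborel K"
    unfolding K_def using a \<epsilon> by (intro integrable_of_real integrable_gamma_kernel)
  have K1eq: "of_real r * K r = complex_of_real (gamma_kernel (a + 1) \<epsilon> r)" for r
    by (auto simp: K_def gamma_kernel_def indicator_def powr_diff)
  have K1: "integrable lborel (\<lambda>r. of_real r * K r)"
    unfolding K1eq using a \<epsilon> by (intro integrable_of_real integrable_gamma_kernel) auto
  have fK: "fourier (gamma_kernel a \<epsilon>) x = inv_fourier K (- x)" for x
    by (simp add: fourier_def inv_fourier_def K_def mult_ac)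
  have fK1: "inv_fourier (\<lambda>\<xi>. \<i> * of_real \<xi> * K \<xi>) (- x)
      = \<i> * fourier (gamma_kernel (a + 1) \<epsilon>) x" for x
    unfolding inv_fourier_def fourier_def mult.assoc K1eq[symmetric]
    by (subst integral_mult_right_zero[symmetric]) (simp add: mult_ac)
  have D1: "(fourier (gamma_kernel a \<epsilon>) has_vector_derivative - (\<i> * fourier (gamma_kernel (a
      + 1) \<epsilon>) x)) (at x)" for x
  proof -
    have "((inv_fourier K \<circ> uminus) has_vector_derivative (- 1) *\<^sub>R (\<i>
        * fourier (gamma_kernel (a + 1) \<epsilon>) x)) (at x)"
      by (rule vector_diff_chain_at)
         (use inv_fourier_has_vector_derivative[OF K K1, of "- x"] in \<open>auto simp: fK1 intro!:
             derivative_eq_intros\<close>)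
    thus ?thesis by (simp add: o_def flip: fK)
  qed
  have D2: "((\<lambda>x. w x powr of_real a) has_vector_derivative of_real a * w x powr (of_real a - 1)
      * \<i>) (at x)" for x
  proof -
    have "((\<lambda>z. (of_real \<epsilon> + \<i> * z) powr of_real a)
        has_field_derivative of_real a * w x powr (of_real a - 1) * \<i>) (at (of_real x))"
      using w[of x] by (auto intro!: derivative_eq_intros simp: w_def)
    thus ?thesis unfolding w_def by (rule has_vector_derivative_real_field)
  qed
  define P where "P = (\<lambda>x. fourier (gamma_kernel a \<epsilon>) x * w x powr of_real a)"
  have "(P has_vector_derivative 0) (at x)" for x
  proof -
    have "(P has_vector_derivative fourier (gamma_kernel a \<epsilon>) x * (of_real a
        * w x powr (of_real a - 1) * \<i>)
       + - (\<i> * fourier (gamma_kernel (a + 1) \<epsilon>) x) * w x powr of_real a) (at x)"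
      unfolding P_def by (rule has_vector_derivative_mult[OF D1 D2])
    also have "w x powr of_real a = w x * w x powr (of_real a - 1)"
      using w[of x] by (simp add: powr_diff)
    also have "fourier (gamma_kernel a \<epsilon>) x * (of_real a * w x powr (of_real a - 1) * \<i>)
       + - (\<i> * fourier (gamma_kernel (a + 1) \<epsilon>) x) * (w x * w x powr (of_real a - 1))
       = \<i> * w x powr (of_real a - 1) * (of_real a * fourier (gamma_kernel a \<epsilon>) x - w x
           * fourier (gamma_kernel (a + 1) \<epsilon>) x)"
      by (simp add: algebra_simps)
    also have "\<dots> = 0"
      using fourier_gamma_kernel_recurrence[OF a \<epsilon>, of x] by (simp add: w_def)
    finally show ?thesis .
  qed
  then obtain c where "\<And>x. P x = c"
    using has_vector_derivative_zero_constant[of UNIV P] by fastforce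
  hence "P \<xi> = P 0" by simp
  also have "P 0 = of_real (Gamma a)"
  proof -
    have "fourier (gamma_kernel a \<epsilon>) 0 = of_real (Gamma a * \<epsilon> powr (- a))"
      using has_bochner_integral_gamma_kernel[OF a \<epsilon>]
      by (simp add: fourier_def has_bochner_integral_iff del: of_real_mult)
    thus ?thesis using \<epsilon> by (simp add: P_def w_def powr_minus powr_of_real)
  qed
  finally show ?thesis using w[of \<xi>]
    by (simp add: P_def powr_minus field_simps w_def)
qed

section \<open>Decay of the transform\<close>

lemma fourier_shift: "fourier (\<lambda>x. f (x + t)) \<xi> = cis (\<xi> * t) * fourier f \<xi>"
proof -
  have "fourier f \<xi> = (LINT x|lborel. of_real (f (t + x)) * cis (- (\<xi> * (t + x))))"
    unfolding fourier_def by (subst lborel_integral_real_affine[where c = 1 and t = t]) auto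
  hence "cis (\<xi> * t) * fourier f \<xi> = (LINT x|lborel. cis (\<xi> * t) * (of_real (f (t + x))
      * cis (- (\<xi> * (t + x)))))"
    by simp
  also have "\<dots> = (LINT x|lborel. of_real (f (x + t)) * cis (- (\<xi> * x)))"
  proof (intro Bochner_Integration.integral_cong refl)
    fix x
    have "cis (\<xi> * t) * cis (- (\<xi> * (t + x))) = cis (- (\<xi> * x))"
      by (simp add: cis_mult algebra_simps)
    thus "cis (\<xi> * t) * (of_real (f (t + x)) * cis (- (\<xi> * (t + x))))
        = of_real (f (x + t)) * cis (- (\<xi> * x))"
      unfolding mult.left_commute[of "cis (\<xi> * t)"] by (simp add: add.commute)
  qed
  finally show ?thesis by (simp add: fourier_def)
qed

text \<open>
  The increment \<open>f (x + t) - f x\<close> is transformed in two ways: by the shift rule, and by Fubini's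
  theorem as the integral of the shifts of \<open>f'\<close>. Only the integral identity between \<open>f\<close> and \<open>f'\<close> is
  used, so \<open>f'\<close> need not be a classical derivative, and no boundary terms at infinity appear.
\<close>

lemma fourier_derivative:
  assumes f: "integrable lborel f" and f': "integrable lborel f'"
    and ftc: "\<And>a b. a \<le> b \<Longrightarrow> f b - f a = (LINT s:{a..b}|lborel. f' s)"
    and \<xi>: "\<xi> \<noteq> 0"
  shows "fourier f' \<xi> = \<i> * of_real \<xi> * fourier f \<xi>"
proof -
  have [measurable]: "f \<in> borel_measurable borel" "f' \<in> borel_measurable borel" using f f' by auto
  \<comment> \<open>With this step \<open>cis (\<xi> * t) - 1 = - 2\<close>, so the common factor can be cancelled.\<close>
  define t where "t = pi / \<bar>\<xi>\<bar>"
  have t: "t > 0" using \<xi> by (simp add: t_def)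
  have c: "cis (\<xi> * t) = -1"
    using \<xi> by (cases "\<xi> > 0") (auto simp: t_def complex_eq_iff)
  let ?h = "\<lambda>s x. of_real (indicator {0..t} s) * (of_real (f' (x + s)) * cis (- (\<xi> * x)))"
  have inc: "of_real (f (x + t) - f x) * cis (- (\<xi> * x)) = (LINT s|lborel. ?h s x)" for x
  proof -
    have "f (x + t) - f x = (LINT s|lborel. indicator {x..x+t} s * f' s)"
      using ftc[of x "x + t"] t by (simp add: set_lebesgue_integral_def)
    also have "\<dots> = (LINT s|lborel. indicator {0..t} s * f' (x + s))"
      by (subst lborel_integral_real_affine[where c = 1 and t = x])
         (auto intro!: Bochner_Integration.integral_cong simp: indicator_def)
    finally have "of_real (f (x + t) - f x) * cis (- (\<xi> * x))
        = (LINT s|lborel. of_real (indicator {0..t} s * f' (x + s))) * cis (- (\<xi> * x))"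
      by (simp only: integral_complex_of_real)
    also have "\<dots> = (LINT s|lborel. of_real (indicator {0..t} s * f' (x + s)) * cis (- (\<xi> * x)))"
      by simp
    finally show ?thesis by (simp add: mult_ac)
  qed
  have ish: "integrable lborel (\<lambda>x. complex_of_real (f' (x + s)) * cis (- (\<xi> * x)))" for s
    using lborel_integrable_real_affine[OF f', of 1 s]
    by (intro integrable_mult_cis integrable_of_real) (auto simp: add.commute)
  have int: "integrable (lborel \<Otimes>\<^sub>M lborel) (case_prod ?h)"
  proof (rule lborel_pair.Fubini_integrable)
    show "AE s in lborel. integrable lborel (\<lambda>x. case_prod ?h (s, x))"
      using ish by (intro AE_I2) simp
    have "(LINT x|lborel. norm (case_prod ?h (s, x)))
        = indicator {0..t} s *\<^sub>R (LINT x|lborel. \<bar>f' x\<bar>)" for s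
    proof -
      have "(LINT x|lborel. \<bar>f' x\<bar>) = (LINT x|lborel. \<bar>f' (x + s)\<bar>)"
        by (subst lborel_integral_real_affine[where c = 1 and t = s]) (auto simp: add.commute)
      thus ?thesis by (simp add: norm_mult)
    qed
    moreover have "integrable lborel (indicator {0..t} :: real \<Rightarrow> real)"
      by (rule integrable_real_indicator) (use t in auto)
    ultimately show "integrable lborel (\<lambda>s. LINT x|lborel. norm (case_prod ?h (s, x)))"
      by simp
  qed measurable
  have cisint: "(LINT s|lborel. of_real (indicator {0..t} s) * cis (\<xi> * s)) = - 2 / (\<i> * of_real \<xi>)"
  proof -
    have "(LINT s|lborel. indicator {0..t} s *\<^sub>R cis (\<xi> * s))
        = cis (\<xi> * t) / (\<i> * of_real \<xi>) - cis (\<xi> * 0) / (\<i> * of_real \<xi>)"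
    proof (rule integral_FTC_atLeastAtMost)
      fix x
      have "((\<lambda>z. exp (\<i> * of_real \<xi> * z) / (\<i> * of_real \<xi>))
          has_field_derivative cis (\<xi> * x)) (at (of_real x))"
        using \<xi> by (auto intro!: derivative_eq_intros simp: cis_conv_exp mult_ac)
      hence "((\<lambda>x. exp (\<i> * of_real \<xi> * of_real x) / (\<i> * of_real \<xi>))
          has_vector_derivative cis (\<xi> * x)) (at x within {0..t})"
        by (rule has_vector_derivative_at_within[OF has_vector_derivative_real_field])
      thus "((\<lambda>x. cis (\<xi> * x) / (\<i> * of_real \<xi>))
          has_vector_derivative cis (\<xi> * x)) (at x within {0..t})"
        by (simp add: cis_conv_exp mult_ac)
    qed (use t in \<open>auto intro!: continuous_intros\<close>)
    also have "\<dots> = - 2 / (\<i> * of_real \<xi>)" unfolding c by (simp add: field_simps)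
    finally show ?thesis by (simp add: scaleR_conv_of_real)
  qed
  have "- 2 * fourier f \<xi> = fourier (\<lambda>x. f (x + t)) \<xi> - fourier f \<xi>"
    by (simp add: fourier_shift c)
  also have "\<dots> = (LINT x|lborel. of_real (f (x + t) - f x) * cis (- (\<xi> * x)))"
  proof -
    have i1: "integrable lborel (\<lambda>x. complex_of_real (f (x + t)) * cis (- (\<xi> * x)))"
      using lborel_integrable_real_affine[OF f, of 1 t]
      by (intro integrable_mult_cis integrable_of_real) (auto simp: add.commute)
    have i2: "integrable lborel (\<lambda>x. complex_of_real (f x) * cis (- (\<xi> * x)))"
      by (intro integrable_mult_cis integrable_of_real f) auto
    show ?thesis
      unfolding fourier_def by (simp add: left_diff_distrib Bochner_Integration.integral_diff[OF
          i1 i2])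
  qed
  also have "\<dots> = (LINT x|lborel. LINT s|lborel. ?h s x)"
    by (simp only: inc)
  also have "\<dots> = (LINT s|lborel. LINT x|lborel. ?h s x)"
    by (rule lborel_pair.Fubini_integral[OF int])
  also have "\<dots> = (LINT s|lborel. (of_real (indicator {0..t} s) * cis (\<xi> * s)) * fourier f' \<xi>)"
    using fourier_shift[of f' _ \<xi>]
    by (simp only: integral_mult_right_zero fourier_def[of "\<lambda>x. f' (x + _)", symmetric] mult.assoc)
  also have "\<dots> = - 2 / (\<i> * of_real \<xi>) * fourier f' \<xi>"
    by (subst integral_mult_left_zero) (simp only: cisint)
  finally show ?thesis using \<xi> by (simp add: field_simps)
qed

lemma fourier_decay:
  assumes "derivs_in_L1 n u"
  shows "\<exists>C. \<forall>\<xi>. \<xi> \<noteq> 0 \<longrightarrow> \<bar>\<xi>\<bar> ^ n * norm (fourier u \<xi>) \<le> C"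
proof -
  obtain D where D0: "D 0 = u" and D1: "\<forall>j\<le>n. integrable lborel (D j)"
    and D2: "\<forall>j<n. \<forall>a b. a \<le> b \<longrightarrow> D j b - D j a = (LINT s:{a..b}|lborel. D (Suc j) s)"
    using assms unfolding derivs_in_L1_def by (elim exE conjE)
  have pw: "fourier (D j) \<xi> = (\<i> * of_real \<xi>) ^ j * fourier u \<xi>" if "j \<le> n" "\<xi> \<noteq> 0" for j \<xi>
    using that(1)
  proof (induction j)
    case (Suc j)
    have "fourier (D (Suc j)) \<xi> = \<i> * of_real \<xi> * fourier (D j) \<xi>"
      by (rule fourier_derivative) (use D1 D2 Suc.prems that in auto)
    thus ?case using Suc by simp
  qed (use D0 in auto)
  have "\<bar>\<xi>\<bar> ^ n * norm (fourier u \<xi>) \<le> (LINT x|lborel. \<bar>D n x\<bar>)" if "\<xi> \<noteq> 0" for \<xi>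
    using pw[of n \<xi>] norm_fourier_le[of "D n" \<xi>] that by (simp add: norm_mult norm_power)
  thus ?thesis by blast
qed

lemma increment_le_L1_norm:
  fixes f f' :: "real \<Rightarrow> real"
  assumes f': "integrable lborel f'" and "a \<le> b"
    and ftc: "f b - f a = (LINT s:{a..b}|lborel. f' s)"
  shows "\<bar>f b - f a\<bar> \<le> (LINT s|lborel. indicator {a..b} s * \<bar>f' s\<bar>)"
  using integral_norm_bound[of lborel "\<lambda>s. indicator {a..b} s *\<^sub>R f' s"]
  unfolding ftc set_lebesgue_integral_def by (simp add: abs_mult)

lemma integrable_powr_weight:
  fixes \<beta> \<gamma> :: real
  assumes "\<beta> > -1" "\<gamma> < -1"
  shows "integrable lborel (\<lambda>x. indicator {0<..1} \<bar>x\<bar> * \<bar>x\<bar> powr \<beta> + indicator {1<..} \<bar>x\<bar>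
      * \<bar>x\<bar> powr \<gamma>)"
proof -
  define w :: "real \<Rightarrow> real" where "w = (\<lambda>x. indicator {0<..1} x * x powr \<beta> + indicator {1<..} x
      * x powr \<gamma>)"
  have "((\<lambda>x. if x \<in> {0..1} then x powr \<beta> else 0) has_integral (1 powr (\<beta>+1) / (\<beta>+1))) UNIV"
    using assms by (subst has_integral_restrict_UNIV) (rule has_integral_powr_from_0; simp)
  hence "((\<lambda>x. indicator {0<..1} x * x powr \<beta>) has_integral (1 powr (\<beta>+1) / (\<beta>+1))) UNIV"
    by (rule has_integral_spike[of "{0}", rotated 2]) (auto simp: indicator_def)
  hence 1: "integrable lborel (\<lambda>x. indicator {0<..1} x * x powr \<beta>)"
    using has_bochner_integral_lborel_of_has_integral by (force simp: has_bochner_integral_iff)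
  have "((\<lambda>x. if x \<in> {1..} then x powr \<gamma> else 0) has_integral (- (1 powr (\<gamma>+1)) / (\<gamma>+1))) UNIV"
    using assms by (subst has_integral_restrict_UNIV) (rule has_integral_powr_to_inf; simp)
  hence "((\<lambda>x. indicator {1<..} x * x powr \<gamma>) has_integral (- (1 powr (\<gamma>+1)) / (\<gamma>+1))) UNIV"
    by (rule has_integral_spike[of "{1}", rotated 2]) (auto simp: indicator_def)
  hence 2: "integrable lborel (\<lambda>x. indicator {1<..} x * x powr \<gamma>)"
    using has_bochner_integral_lborel_of_has_integral by (force simp: has_bochner_integral_iff)
  have w: "integrable lborel w"
    unfolding w_def by (intro Bochner_Integration.integrable_add 1 2)
  have "integrable lborel (\<lambda>x. w x + w (0 + (-1) * x))"
    by (intro Bochner_Integration.integrable_add w lborel_integrable_real_affine) auto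
  also have "(\<lambda>x. w x + w (0 + (-1) * x)) = (\<lambda>x. indicator {0<..1} \<bar>x\<bar> * \<bar>x\<bar> powr \<beta>
      + indicator {1<..} \<bar>x\<bar> * \<bar>x\<bar> powr \<gamma>)"
    by (auto simp: w_def indicator_def fun_eq_iff abs_if)
  finally show ?thesis .
qed

text \<open>
  Near \<open>0\<close> the transform is bounded, which allows \<open>\<beta>\<close> down to \<open>- 1\<close>; at infinity it decays like
  \<open>\<bar>\<xi>\<bar> powr - n\<close>.
\<close>

lemma integrable_weighted_fourier:
  assumes u: "derivs_in_L1 n u" and \<beta>: "\<beta> > -1" "\<beta> < real n - 1"
  shows "integrable lborel (\<lambda>\<xi>. \<bar>\<xi>\<bar> powr \<beta> * norm (fourier u \<xi>))"
proof -
  have iu: "integrable lborel u"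
    using u unfolding derivs_in_L1_def by (metis le0)
  hence [measurable]: "u \<in> borel_measurable borel" by auto
  obtain C where C: "\<And>\<xi>. \<xi> \<noteq> 0 \<Longrightarrow> \<bar>\<xi>\<bar> ^ n * norm (fourier u \<xi>) \<le> C"
    using fourier_decay[OF u] by blast
  define B where "B = max C (LINT x|lborel. \<bar>u x\<bar>)"
  show ?thesis
  proof (rule Bochner_Integration.integrable_bound[OF integrable_mult_right[OF
      integrable_powr_weight[of \<beta> "\<beta> - real n"], of B]])
    show "AE \<xi> in lborel. norm (\<bar>\<xi>\<bar> powr \<beta> * norm (fourier u \<xi>))
        \<le> norm (B * (indicator {0<..1} \<bar>\<xi>\<bar> * \<bar>\<xi>\<bar> powr \<beta> + indicator {1<..} \<bar>\<xi>\<bar> * \<bar>\<xi>\<bar> powr (\<beta>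
            - real n)))"
    proof (intro AE_I2)
      fix \<xi> :: real
      consider "\<xi> = 0" | "0 < \<bar>\<xi>\<bar>" "\<bar>\<xi>\<bar> \<le> 1" | "\<bar>\<xi>\<bar> > 1" by linarith
      thus "norm (\<bar>\<xi>\<bar> powr \<beta> * norm (fourier u \<xi>))
          \<le> norm (B * (indicator {0<..1} \<bar>\<xi>\<bar> * \<bar>\<xi>\<bar> powr \<beta> + indicator {1<..} \<bar>\<xi>\<bar> * \<bar>\<xi>\<bar> powr (\<beta>
              - real n)))"
      proof cases
        case 2
        have "norm (fourier u \<xi>) \<le> \<bar>B\<bar>"
          using norm_fourier_le[of u \<xi>] by (simp add: B_def)
        thus ?thesis using 2 by (simp add: abs_mult mult.commute[of "\<bar>\<xi>\<bar> powr \<beta>"] mult_right_mono)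
      next
        case 3
        hence nz: "\<xi> \<noteq> 0" by auto
        have "\<bar>\<xi>\<bar> ^ n * norm (fourier u \<xi>) \<le> \<bar>B\<bar>"
          using C[OF nz] by (simp add: B_def)
        hence "norm (fourier u \<xi>) \<le> \<bar>B\<bar> / \<bar>\<xi>\<bar> ^ n"
          using nz by (simp add: field_simps)
        hence "\<bar>\<xi>\<bar> powr \<beta> * norm (fourier u \<xi>) \<le> \<bar>\<xi>\<bar> powr \<beta> * (\<bar>B\<bar> / \<bar>\<xi>\<bar> ^ n)"
          by (intro mult_left_mono) auto
        also have "\<dots> = \<bar>B\<bar> * \<bar>\<xi>\<bar> powr (\<beta> - real n)"
          using nz by (simp add: powr_diff powr_realpow)
        finally show ?thesis using 3 by (simp add: abs_mult)
      qed auto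
    qed
  qed (use \<beta> in auto)
qed

section \<open>Multiplier of the Riemann-Liouville derivative\<close>

lemma borel_measurable_complex_powr_const [measurable]:
  fixes f :: "'a \<Rightarrow> complex"
  assumes [measurable]: "f \<in> borel_measurable M"
  shows "(\<lambda>x. f x powr c) \<in> borel_measurable M"
  unfolding powr_def by measurable

lemma derivs_in_L1_integrable: "derivs_in_L1 n u \<Longrightarrow> integrable lborel u"
  unfolding derivs_in_L1_def by (metis le0)

lemma derivs_in_L1_bounded:
  assumes "derivs_in_L1 n u" "n \<ge> 1"
  shows "\<exists>B. \<forall>x. \<bar>u x\<bar> \<le> B"
proof -
  obtain u' where u': "integrable lborel u'" and ftc: "\<And>a b. a \<le> b \<Longrightarrow> u b - u a
      = (LINT s:{a..b}|lborel. u' s)"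
    using assms unfolding derivs_in_L1_def by (metis One_nat_def less_eq_Suc_le)
  have inc: "\<bar>u b - u a\<bar> \<le> (LINT s|lborel. \<bar>u' s\<bar>)" if "a \<le> b" for a b
  proof -
    have "\<bar>u b - u a\<bar> \<le> (LINT s|lborel. indicator {a..b} s * \<bar>u' s\<bar>)"
      by (rule increment_le_L1_norm[OF u' that ftc[OF that]])
    also have "\<dots> \<le> (LINT s|lborel. \<bar>u' s\<bar>)"
    proof (rule integral_mono)
      show "integrable lborel (\<lambda>s. indicator {a..b} s * \<bar>u' s\<bar>)"
        using integrable_mult_indicator[of "{a..b}" lborel "\<lambda>s. \<bar>u' s\<bar>"] u' by simp
    qed (use u' in \<open>auto simp: indicator_def\<close>)
    finally show ?thesis .
  qed
  have "\<bar>u x\<bar> \<le> \<bar>u 0\<bar> + (LINT s|lborel. \<bar>u' s\<bar>)" for x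
    using inc[of 0 x] inc[of x 0] by (cases "x \<ge> 0") auto
  thus ?thesis by blast
qed

lemma integrable_fourier:
  assumes u: "derivs_in_L1 n u" and n: "n \<ge> 2"
  shows "integrable lborel (fourier u)"
proof (rule Bochner_Integration.integrable_bound[OF integrable_weighted_fourier[OF u, of 0]])
  have [measurable]: "u \<in> borel_measurable borel" using derivs_in_L1_integrable[OF u] by auto
  show "fourier u \<in> borel_measurable lborel" by simp
  show "AE \<xi> in lborel. norm (fourier u \<xi>) \<le> norm (\<bar>\<xi>\<bar> powr 0 * norm (fourier u \<xi>))"
    using AE_lborel_singleton[of 0] by eventually_elim simp
qed (use n in auto)

lemma derivs_in_L1_inversion:
  assumes u: "derivs_in_L1 n u" and n: "n \<ge> 2" and cont: "continuous_on UNIV u"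
  shows "inv_fourier (fourier u) x = of_real (2 * pi * u x)"
proof -
  obtain B where "\<And>x. \<bar>u x\<bar> \<le> B" using derivs_in_L1_bounded[OF u] n by auto
  thus ?thesis
    using fourier_inversion[OF derivs_in_L1_integrable[OF u] integrable_fourier[OF u n] cont]
        by blast
qed

lemma integrable_gamma_kernel_0_mult:
  assumes a: "0 < a" "a < 1" and u: "integrable lborel u" and B: "\<And>x. \<bar>u x\<bar> \<le> B"
  shows "integrable lborel (\<lambda>r. gamma_kernel a 0 r * u (y - r))"
proof (rule Bochner_Integration.integrable_bound)
  have [measurable]: "u \<in> borel_measurable borel" using u by auto
  show "(\<lambda>r. gamma_kernel a 0 r * u (y - r)) \<in> borel_measurable lborel" by measurable
  let ?w = "\<lambda>r. indicator {0<..1} \<bar>r\<bar> * \<bar>r\<bar> powr (a - 1) + indicator {1<..} \<bar>r\<bar> * \<bar>r\<bar> powr (-2)"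
  show "integrable lborel (\<lambda>r. B * ?w r + \<bar>u (y + (-1) * r)\<bar>)"
    using lborel_integrable_real_affine[OF u, of "-1" y] a
    by (intro Bochner_Integration.integrable_add integrable_mult_right integrable_powr_weight
        integrable_abs) auto
  have B0: "B \<ge> 0" using B[of 0] by linarith
  show "AE r in lborel. norm (gamma_kernel a 0 r * u (y - r))
      \<le> norm (B * ?w r + \<bar>u (y + (-1) * r)\<bar>)"
  proof (intro AE_I2)
    fix r :: real
    have w0: "?w r \<ge> 0" by auto
    consider "r \<le> 0" | "0 < r" "r \<le> 1" | "r > 1" by linarith
    hence "\<bar>gamma_kernel a 0 r * u (y - r)\<bar> \<le> B * ?w r + \<bar>u (y - r)\<bar>"
    proof cases
      case 1
      thus ?thesis using mult_nonneg_nonneg[OF B0 w0] by (simp add: gamma_kernel_def)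
    next
      case 2
      have "\<bar>gamma_kernel a 0 r * u (y - r)\<bar> = r powr (a - 1) * \<bar>u (y - r)\<bar>"
        using 2 by (simp add: gamma_kernel_def abs_mult)
      also have "\<dots> \<le> r powr (a - 1) * B" by (intro mult_left_mono B) auto
      finally show ?thesis using 2 by (simp add: mult.commute)
    next
      case 3
      have "r powr (a - 1) \<le> r powr 0" using 3 a by (intro powr_mono) auto
      hence "r powr (a - 1) * \<bar>u (y - r)\<bar> \<le> 1 * \<bar>u (y - r)\<bar>"
        using 3 by (intro mult_right_mono) auto
      moreover have "\<bar>gamma_kernel a 0 r * u (y - r)\<bar> = r powr (a - 1) * \<bar>u (y - r)\<bar>"
        using 3 by (simp add: gamma_kernel_def abs_mult)
      moreover have "0 \<le> B * ?w r" using B0 w0 by (rule mult_nonneg_nonneg)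
      ultimately show ?thesis by linarith
    qed
    hence "\<bar>gamma_kernel a 0 r * u (y - r)\<bar> \<le> \<bar>B * ?w r + \<bar>u (y - r)\<bar>\<bar>"
      by (rule order_trans[OF _ abs_ge_self])
    thus "norm (gamma_kernel a 0 r * u (y - r)) \<le> norm (B * ?w r + \<bar>u (y + (-1) * r)\<bar>)"
      by simp
  qed
qed

lemma fractional_integral_fourier_regularised:
  assumes a: "0 < a" and \<epsilon>: "\<epsilon> > 0" and u: "integrable lborel (fourier u)" "integrable lborel u"
    and inv: "\<And>x. inv_fourier (fourier u) x = of_real (2 * pi * u x)"
  shows "of_real (2 * pi) * (LINT r|lborel. complex_of_real (gamma_kernel a \<epsilon> r * u (y - r)))
       = of_real (Gamma a) * (LINT \<xi>|lborel. (of_real \<epsilon> + \<i> * of_real \<xi>) powr (- of_real a)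
           * fourier u \<xi> * cis (\<xi> * y))"
proof -
  have [measurable]: "u \<in> borel_measurable borel" using u by auto
  let ?g = "\<lambda>\<xi> r. (of_real (gamma_kernel a \<epsilon> r) * cis (- (\<xi> * r))) * (fourier u \<xi> * cis (\<xi> * y))"
  have int: "integrable (lborel \<Otimes>\<^sub>M lborel) (case_prod ?g)"
    by (rule integrable_pair_dominated[OF _ integrable_norm[OF u(1)] integrable_norm[OF
        integrable_gamma_kernel[OF a \<epsilon>]]])
       (auto simp: norm_mult)
  have "of_real (2 * pi) * (LINT r|lborel. complex_of_real (gamma_kernel a \<epsilon> r * u (y - r)))
      = (LINT r|lborel. of_real (gamma_kernel a \<epsilon> r) * inv_fourier (fourier u) (y - r))"
    unfolding inv by (subst integral_mult_right_zero[symmetric]) (simp add: mult_ac)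
  also have "\<dots> = (LINT r|lborel. LINT \<xi>|lborel. ?g \<xi> r)"
  proof (intro Bochner_Integration.integral_cong refl)
    fix r
    have c: "cis (\<xi> * (y - r)) = cis (- (\<xi> * r)) * cis (\<xi> * y)" for \<xi>
      by (simp add: cis_mult algebra_simps)
    show "of_real (gamma_kernel a \<epsilon> r) * inv_fourier (fourier u) (y - r) = (LINT \<xi>|lborel. ?g \<xi> r)"
      unfolding inv_fourier_def c
      by (subst integral_mult_right_zero[symmetric]) (simp add: mult_ac)
  qed
  also have "\<dots> = (LINT \<xi>|lborel. LINT r|lborel. ?g \<xi> r)"
    by (rule lborel_pair.Fubini_integral[OF int])
  also have "\<dots> = (LINT \<xi>|lborel. fourier (gamma_kernel a \<epsilon>) \<xi> * (fourier u \<xi> * cis (\<xi> * y)))"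
    unfolding fourier_def[of "gamma_kernel a \<epsilon>"] by (simp only: integral_mult_left_zero)
  also have "\<dots> = of_real (Gamma a) * (LINT \<xi>|lborel. (of_real \<epsilon> + \<i>
      * of_real \<xi>) powr (- of_real a) * fourier u \<xi> * cis (\<xi> * y))"
    unfolding fourier_gamma_kernel[OF a \<epsilon>] by (subst integral_mult_right_zero[symmetric])
        (simp add: mult_ac)
  finally show ?thesis .
qed

text \<open>
  The fractional integral acts on the Fourier side as multiplication by \<open>(\<i>\<xi>) powr - a\<close>. This is the
  limit \<open>\<epsilon> \<rightarrow> 0\<close> of the damped identity; the assumption \<open>a < 1\<close> makes the multiplier integrable near
  \<open>\<xi> = 0\<close>.
\<close>

lemma fractional_integral_fourier:
  assumes a: "0 < a" "a < 1" and u: "derivs_in_L1 n u" "n \<ge> 2" and cont: "continuous_on UNIV u"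
  shows "of_real (2 * pi * (LINT r|lborel. gamma_kernel a 0 r * u (y - r)))
       = of_real (Gamma a) * inv_fourier (\<lambda>\<xi>. (\<i> * of_real \<xi>) powr (- of_real a) * fourier u \<xi>) y"
proof -
  have iu: "integrable lborel u" by (rule derivs_in_L1_integrable[OF u(1)])
  hence [measurable]: "u \<in> borel_measurable borel" by auto
  obtain B where B: "\<And>x. \<bar>u x\<bar> \<le> B" using derivs_in_L1_bounded[OF u(1)] u by auto
  have iF: "integrable lborel (fourier u)" by (rule integrable_fourier[OF u])
  let ?L = "\<lambda>\<epsilon>. LINT r|lborel. complex_of_real (gamma_kernel a \<epsilon> r * u (y - r))"
  let ?R = "\<lambda>\<epsilon>. LINT \<xi>|lborel. (of_real \<epsilon> + \<i> * of_real \<xi>) powr (- of_real a) * fourier u \<xi>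
      * cis (\<xi> * y)"
  \<comment> \<open>A separate name keeps the rewrite rule for the damped kernel from applying to its own right-hand side.\<close>
  define k0 where "k0 = gamma_kernel a 0"
  have gk: "gamma_kernel a \<epsilon> r = k0 r * exp (- (\<epsilon> * r))" for \<epsilon> r
    by (simp add: k0_def gamma_kernel_def)
  have L: "(?L \<longlongrightarrow> ?L 0) (at_right 0)"
  proof (rule tendsto_integral_dominated_within[where w = "\<lambda>r. \<bar>gamma_kernel a 0 r * u (y - r)\<bar>"])
    show "integrable lborel (\<lambda>r. \<bar>gamma_kernel a 0 r * u (y - r)\<bar>)"
      by (intro integrable_abs integrable_gamma_kernel_0_mult[OF a iu B])
    show "AE r in lborel. ((\<lambda>\<epsilon>. complex_of_real (gamma_kernel a \<epsilon> r * u (y - r)))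
        \<longlongrightarrow> complex_of_real (gamma_kernel a 0 r * u (y - r))) (at_right 0)"
      unfolding gk by (intro AE_I2 tendsto_intros)
    show "AE r in lborel. norm (complex_of_real (gamma_kernel a \<epsilon> r * u (y - r)))
        \<le> \<bar>gamma_kernel a 0 r * u (y - r)\<bar>"
      if "\<epsilon> \<in> {0<..}" for \<epsilon>
    proof (intro AE_I2)
      fix r
      show "norm (complex_of_real (gamma_kernel a \<epsilon> r * u (y - r)))
          \<le> \<bar>gamma_kernel a 0 r * u (y - r)\<bar>"
        using that by (cases "r > 0") (auto simp: gamma_kernel_def abs_mult norm_mult intro!:
            mult_left_le_one_le)
    qed
  qed measurable
  have R: "(?R \<longlongrightarrow> ?R 0) (at_right 0)"
  proof (rule tendsto_integral_dominated_within[where w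
      = "\<lambda>\<xi>. \<bar>\<xi>\<bar> powr (- a) * norm (fourier u \<xi>)"])
    show "integrable lborel (\<lambda>\<xi>. \<bar>\<xi>\<bar> powr (- a) * norm (fourier u \<xi>))"
      using a u by (intro integrable_weighted_fourier) auto
    show "AE \<xi> in lborel. ((\<lambda>\<epsilon>. (of_real \<epsilon> + \<i> * of_real \<xi>) powr (- of_real a) * fourier u \<xi>
        * cis (\<xi> * y)) \<longlongrightarrow>
       (of_real 0 + \<i> * of_real \<xi>) powr (- of_real a) * fourier u \<xi> * cis (\<xi> * y)) (at_right 0)"
      using AE_lborel_singleton[of 0]
    proof eventually_elim
      case (elim \<xi>)
      show ?case using elim
        by (intro tendsto_mult tendsto_const tendsto_powr_complex tendsto_add tendsto_of_real
            tendsto_ident_at)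
           (auto simp: complex_nonpos_Reals_iff)
    qed
    show "AE \<xi> in lborel. norm ((of_real \<epsilon> + \<i> * of_real \<xi>) powr (- of_real a) * fourier u \<xi>
        * cis (\<xi> * y)) \<le> \<bar>\<xi>\<bar> powr (- a) * norm (fourier u \<xi>)"
      if "\<epsilon> \<in> {0<..}" for \<epsilon>
      using AE_lborel_singleton[of 0]
    proof eventually_elim
      case (elim \<xi>)
      define w where "w = of_real \<epsilon> + \<i> * complex_of_real \<xi>"
      have "\<bar>\<xi>\<bar> \<le> norm w" using abs_Im_le_cmod[of w] by (simp add: w_def)
      hence "norm w powr (- a) \<le> \<bar>\<xi>\<bar> powr (- a)"
        using elim a by (intro powr_mono2') auto
      moreover have "norm (w powr (- of_real a)) = norm w powr (- a)"
        by (subst norm_powr_real_powr') auto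
      ultimately show ?case by (simp add: norm_mult mult_right_mono flip: w_def)
    qed
  qed measurable
  have "((\<lambda>\<epsilon>. of_real (2 * pi) * ?L \<epsilon>) \<longlongrightarrow> of_real (2 * pi) * ?L 0) (at_right 0)"
    by (intro tendsto_mult tendsto_const L)
  moreover have "((\<lambda>\<epsilon>. of_real (2 * pi) * ?L \<epsilon>) \<longlongrightarrow> of_real (Gamma a) * ?R 0) (at_right 0)"
    by (rule Lim_transform_eventually[OF tendsto_mult[OF tendsto_const R]])
       (intro eventually_mono[OF eventually_at_right_less[of 0]],
        rule fractional_integral_fourier_regularised[symmetric, OF a(1) _ iF iu
            derivs_in_L1_inversion[OF u cont]])
  ultimately have "of_real (2 * pi) * ?L 0 = of_real (Gamma a) * ?R 0"
    by (rule tendsto_unique[OF trivial_limit_at_right_real])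
  thus ?thesis by (simp add: inv_fourier_def del: of_real_mult) (simp add: mult_ac)
qed

lemma second_deriv_eq:
  fixes f :: "real \<Rightarrow> real"
  assumes "\<And>y. (f has_real_derivative f1 y) (at y)" "\<And>y. (f1 has_real_derivative f2 y) (at y)"
  shows "(deriv ^^ 2) f x = f2 x"
proof -
  have "deriv f = f1" by (intro ext DERIV_imp_deriv assms)
  thus ?thesis using assms by (simp add: numeral_2_eq_2 DERIV_imp_deriv)
qed

text \<open>
  The integral in the left Riemann-Liouville derivative is a fractional integral of order \<open>2 - \<alpha>\<close>;
  two differentiations under the inverse Fourier integral turn its multiplier into
  \<open>(\<i>\<xi>) powr \<alpha>\<close>. Differentiability is stated explicitly because it is also needed for the reflection
  \<open>y \<mapsto> - y\<close>.
\<close>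

lemma fractional_integral_derivatives:
  fixes u :: "real \<Rightarrow> real"
  assumes \<alpha>: "1 < \<alpha>" "\<alpha> < 2" and u: "derivs_in_L1 n u" "n \<ge> 4" and cont: "continuous_on UNIV u"
  defines "G \<equiv> \<lambda>y. LINT s:{..<y}|lborel. u s / (y - s) powr (\<alpha> - 1)"
  shows "\<exists>G1 G2. (\<forall>y. (G has_real_derivative G1 y) (at y))
      \<and> (\<forall>y. (G1 has_real_derivative G2 y) (at y)) \<and>
     (\<forall>y. 2 * pi * G2 y = Gamma (2 - \<alpha>) * Re (inv_fourier (\<lambda>\<xi>. (\<i> * of_real \<xi>) powr of_real \<alpha>
         * fourier u \<xi>) y))"
proof -
  have [measurable]: "u \<in> borel_measurable borel" using derivs_in_L1_integrable[OF u(1)] by auto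
  define F where "F = (\<lambda>\<xi>. (\<i> * of_real \<xi>) powr (of_real \<alpha> - 2) * fourier u \<xi>)"
  have [measurable]: "F \<in> borel_measurable borel" unfolding F_def by measurable
  define c where "c = Gamma (2 - \<alpha>) / (2 * pi)"
  have G: "G y = c * Re (inv_fourier F y)" for y
  proof -
    have "G y = (LINT r|lborel. gamma_kernel (2 - \<alpha>) 0 r * u (y - r))"
      unfolding G_def set_lebesgue_integral_def
      by (subst lborel_integral_real_affine[where c = "-1" and t = y])
         (auto simp: gamma_kernel_def indicator_def powr_minus field_simps powr_diff intro!:
             Bochner_Integration.integral_cong)
    hence "of_real (2 * pi * G y) = of_real (Gamma (2 - \<alpha>)) * inv_fourier F y"
      using fractional_integral_fourier[of "2 - \<alpha>" n u y] \<alpha> u cont by (simp add: F_def)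
    hence "Re (of_real (2 * pi * G y)) = Re (of_real (Gamma (2 - \<alpha>)) * inv_fourier F y)" by simp
    thus ?thesis by (simp add: c_def field_simps)
  qed
  have nF: "norm (F \<xi>) = \<bar>\<xi>\<bar> powr (\<alpha> - 2) * norm (fourier u \<xi>)" for \<xi>
    using norm_i_powr[of \<xi> "\<alpha> - 2"] by (simp add: F_def norm_mult)
  have F0: "integrable lborel (\<lambda>\<xi>. of_real \<xi> ^ k * F \<xi>)" if "k \<le> 2" for k
  proof (rule Bochner_Integration.integrable_bound[OF integrable_weighted_fourier[OF u(1), of "\<alpha>
      - 2 + real k"]])
    have "norm (of_real \<xi> ^ k * F \<xi>) = \<bar>\<xi>\<bar> powr (\<alpha> - 2 + real k) * norm (fourier u \<xi>)"
        if "\<xi> \<noteq> 0" for \<xi>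
      using that by (simp add: norm_mult norm_power nF powr_add powr_realpow)
    thus "AE \<xi> in lborel. norm (of_real \<xi> ^ k * F \<xi>)
        \<le> norm (\<bar>\<xi>\<bar> powr (\<alpha> - 2 + real k) * norm (fourier u \<xi>))"
      using AE_lborel_singleton[of 0] by (auto elim!: eventually_mono)
  qed (use \<alpha> u that in auto)
  define F1 where "F1 = (\<lambda>\<xi>. \<i> * of_real \<xi> * F \<xi>)"
  define F2 where "F2 = (\<lambda>\<xi>. \<i> * of_real \<xi> * F1 \<xi>)"
  have i0: "integrable lborel F" and i1: "integrable lborel (\<lambda>\<xi>. of_real \<xi> * F \<xi>)"
    using F0[of 0] F0[of 1] by simp_all
  have j0: "integrable lborel F1"
    using integrable_mult_right[OF i1, of \<i>] by (simp add: F1_def mult_ac)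
  have j1: "integrable lborel (\<lambda>\<xi>. of_real \<xi> * F1 \<xi>)"
    using integrable_mult_right[OF F0[of 2], of \<i>] by (simp add: F1_def power2_eq_square mult_ac)
  have Re_deriv: "((\<lambda>y. c * Re (H y)) has_real_derivative c * Re D) (at y)"
    if "(H has_vector_derivative D) (at y)" for H D y
    using bounded_linear.has_vector_derivative[OF bounded_linear_Re that]
    by (intro DERIV_cmult) (simp add: has_real_derivative_iff_has_vector_derivative)
  have d1: "(G has_real_derivative c * Re (inv_fourier F1 y)) (at y)" for y
    unfolding G[abs_def] F1_def by (rule Re_deriv[OF inv_fourier_has_vector_derivative[OF i0 i1]])
  have d2: "((\<lambda>y. c * Re (inv_fourier F1 y)) has_real_derivative c
      * Re (inv_fourier F2 y)) (at y)" for y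
    unfolding F2_def by (rule Re_deriv[OF inv_fourier_has_vector_derivative[OF j0 j1]])
  have F2: "F2 = (\<lambda>\<xi>. (\<i> * of_real \<xi>) powr of_real \<alpha> * fourier u \<xi>)"
  proof
    fix \<xi>
    show "F2 \<xi> = (\<i> * of_real \<xi>) powr of_real \<alpha> * fourier u \<xi>"
    proof (cases "\<xi> = 0")
      case False
      hence "(\<i> * of_real \<xi>) powr (of_real \<alpha> - 2)
          = (\<i> * of_real \<xi>) powr of_real \<alpha> / (\<i> * of_real \<xi>)\<^sup>2"
        by (simp add: powr_diff)
      thus ?thesis using False by (simp add: F2_def F1_def F_def power2_eq_square)
    qed (simp add: F2_def)
  qed
  show ?thesis
    by (rule exI[of _ "\<lambda>y. c * Re (inv_fourier F1 y)"], rule exI[of _ "\<lambda>y. c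
        * Re (inv_fourier F2 y)"])
       (use d1 d2 in \<open>auto simp: c_def F2\<close>)
qed

lemma RL_left_fourier:
  assumes \<alpha>: "1 < \<alpha>" "\<alpha> < 2" and u: "derivs_in_L1 n u" "n \<ge> 4" and cont: "continuous_on UNIV u"
  shows "2 * pi * RL_left \<alpha> u x = Re (inv_fourier (\<lambda>\<xi>. (\<i> * of_real \<xi>) powr of_real \<alpha>
      * fourier u \<xi>) x)"
proof -
  obtain G1 G2 where
    "\<And>y. ((\<lambda>y. LINT s:{..<y}|lborel. u s / (y - s) powr (\<alpha> - 1)) has_real_derivative G1 y) (at y)"
    "\<And>y. (G1 has_real_derivative G2 y) (at y)"
    and G2: "2 * pi * G2 x = Gamma (2 - \<alpha>) * Re (inv_fourier (\<lambda>\<xi>. (\<i> * of_real \<xi>) powr of_real \<alpha>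
        * fourier u \<xi>) x)"
    using fractional_integral_derivatives[OF assms] by blast
  hence "RL_left \<alpha> u x = 1 / Gamma (2 - \<alpha>) * G2 x"
    unfolding RL_left_def by (subst second_deriv_eq) auto
  moreover have "Gamma (2 - \<alpha>) > 0" using \<alpha> by (intro Gamma_real_pos) auto
  ultimately show ?thesis using G2 by simp
qed

lemma RL_right_reflect:
  assumes \<alpha>: "1 < \<alpha>" "\<alpha> < 2" and v: "derivs_in_L1 n v" "n \<ge> 4" and cont: "continuous_on UNIV v"
    and uv: "\<And>x. v x = u (- x)"
  shows "RL_right \<alpha> u x = RL_left \<alpha> v (- x)"
proof -
  define G where "G = (\<lambda>y. LINT s:{..<y}|lborel. v s / (y - s) powr (\<alpha> - 1))"
  define H where "H = (\<lambda>y. LINT s:{y<..}|lborel. u s / (s - y) powr (\<alpha> - 1))"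
  obtain G1 G2 where G1: "\<And>y. (G has_real_derivative G1 y) (at y)"
    and G2: "\<And>y. (G1 has_real_derivative G2 y) (at y)"
    unfolding G_def using fractional_integral_derivatives[OF \<alpha> v cont] by blast
  have "H y = G (- y)" for y
    unfolding H_def G_def set_lebesgue_integral_def
    by (subst lborel_integral_real_affine[where c = "-1" and t = 0])
       (auto simp: indicator_def uv intro!: Bochner_Integration.integral_cong)
  hence H: "H = (\<lambda>y. G (- y))" by auto
  have "(H has_real_derivative - G1 (- y)) (at y)" for y
    unfolding H using DERIV_mirror[of G "G1 (- y)" y] G1[of "- y"] by simp
  moreover have "((\<lambda>y. - G1 (- y)) has_real_derivative G2 (- y)) (at y)" for y
    using DERIV_minus[of "\<lambda>y. G1 (- y)" "- G2 (- y)"] DERIV_mirror[of G1 "G2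
        (- y)" y] G2[of "- y"] by simp
  ultimately have "(deriv ^^ 2) H x = G2 (- x)" by (rule second_deriv_eq)
  moreover have "(deriv ^^ 2) G (- x) = G2 (- x)" by (rule second_deriv_eq[OF G1 G2])
  ultimately show ?thesis
    unfolding RL_right_def RL_left_def by (simp add: H_def G_def)
qed

section \<open>Multiplier of the difference operator\<close>

text \<open>
  Cauchy's inequality on circles of radius \<open>r < 1\<close>, in the limit \<open>r \<rightarrow> 1\<close>.
\<close>

lemma kappa2_bounded:
  assumes \<alpha>: "\<alpha> > 0" and M: "\<And>z. norm z \<le> 1 \<Longrightarrow> norm (gen_poly \<alpha> z powr of_real \<alpha>) \<le> M"
  shows "\<bar>kappa2 \<alpha> l\<bar> \<le> M"
proof -
  define f where "f = (\<lambda>z. gen_poly \<alpha> z powr of_real \<alpha>)"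
  have "gen_poly \<alpha> holomorphic_on ball 0 1"
    unfolding gen_poly_def[abs_def] by (intro holomorphic_intros)
  hence holo: "f holomorphic_on ball 0 1"
    unfolding f_def
    by (intro holomorphic_on_powr holomorphic_intros gen_poly_not_nonpos_Reals \<alpha>) auto
  have "(\<lambda>l. (deriv ^^ l) f 0 / fact l) = (\<lambda>l. complex_of_real (kappa2 \<alpha> l))"
  proof (rule power_series_coeff_unique[of _ f])
    show "(\<lambda>l. (deriv ^^ l) f 0 / fact l * z ^ l) sums f z" if "norm z < 1" for z
      using holomorphic_power_series[OF holo, of z] that by simp
    show "(\<lambda>l. of_real (kappa2 \<alpha> l) * z ^ l) sums f z" if "norm z < 1" for z
      unfolding f_def by (rule kappa2_sums[OF \<alpha> that])
  qed
  hence coeff: "(deriv ^^ l) f 0 = fact l * of_real (kappa2 \<alpha> l)"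
    by (auto simp: fun_eq_iff field_simps)
  have r: "\<bar>kappa2 \<alpha> l\<bar> * r ^ l \<le> M" if r: "0 < r" "r < 1" for r
  proof -
    have "norm ((deriv ^^ l) f 0) \<le> fact l * M / r ^ l"
    proof (rule Cauchy_inequality)
      show "f holomorphic_on ball 0 r" by (rule holomorphic_on_subset[OF holo]) (use r in auto)
      show "continuous_on (cball 0 r) f"
        by (rule holomorphic_on_imp_continuous_on, rule holomorphic_on_subset[OF holo])
            (use r in auto)
      show "norm (f x) \<le> M" if "norm (0 - x) = r" for x
        unfolding f_def using M[of x] that r by simp
    qed (use r in auto)
    thus ?thesis using r by (simp add: coeff norm_mult field_simps)
  qed
  have "((\<lambda>r. \<bar>kappa2 \<alpha> l\<bar> * r ^ l) \<longlongrightarrow> \<bar>kappa2 \<alpha> l\<bar> * 1 ^ l) (at_left 1)"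
    by (intro tendsto_intros)
  moreover have "\<forall>\<^sub>F r in at_left (1::real). \<bar>kappa2 \<alpha> l\<bar> * r ^ l \<le> M"
    using eventually_at_left_real[of 0 "1::real"] by (auto elim!: eventually_mono intro: r)
  ultimately have "\<bar>kappa2 \<alpha> l\<bar> * 1 ^ l \<le> M"
    by (intro tendsto_upperbound[of _ _ "at_left 1"]) auto
  thus ?thesis by simp
qed

lemma gen_poly_closed_disc:
  assumes \<alpha>: "\<alpha> > 0" and z: "norm z \<le> 1"
  shows "gen_poly \<alpha> z \<notin> \<real>\<^sub>\<le>\<^sub>0 \<or> gen_poly \<alpha> z = 0"
proof (cases "z = 1")
  case True
  thus ?thesis using gen_poly_1[OF \<alpha>] by simp
next
  case False
  define x y where "x = Re z" and "y = Im z"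
  have zxy: "z = Complex x y" by (simp add: x_def y_def)
  have xy: "x\<^sup>2 + y\<^sup>2 \<le> 1" using z by (simp add: x_def y_def cmod_def)
  have x1: "x \<le> 1" using complex_Re_le_cmod[of z] z by (simp add: x_def)
  have xn1: "x \<noteq> 1" using False xy by (auto simp: zxy complex_eq_iff)
  have im: "Im (gen_poly \<alpha> z) = y * ((\<alpha> + 2) * x - 2 * (\<alpha> + 1)) / \<alpha>"
    using \<alpha> by (simp add: gen_poly_def zxy power2_eq_square field_simps)
  have lt: "(\<alpha> + 2) * x < (\<alpha> + 2) * 1"
    using x1 xn1 \<alpha> by (intro mult_strict_left_mono) auto
  hence "(\<alpha> + 2) * x - 2 * (\<alpha> + 1) < 0" using \<alpha> by (simp only: ring_distribs)
  hence ne: "(\<alpha> + 2) * x - 2 * (\<alpha> + 1) \<noteq> 0" by (rule less_imp_neq)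
  show ?thesis
  proof (cases "y = 0")
    case True
    have "Re (gen_poly \<alpha> z) = (1 - x) * ((3 * \<alpha> + 2) - (\<alpha> + 2) * x) / (2 * \<alpha>)"
      using \<alpha> True by (simp add: gen_poly_def zxy power2_eq_square field_simps)
    moreover have "(3 * \<alpha> + 2) - (\<alpha> + 2) * x > 0"
      using lt \<alpha> by (simp only: ring_distribs)
    ultimately have "Re (gen_poly \<alpha> z) > 0"
      using x1 xn1 \<alpha> by simp
    thus ?thesis by (simp add: complex_nonpos_Reals_iff)
  next
    case False
    thus ?thesis using im ne \<alpha> by (simp add: complex_nonpos_Reals_iff)
  qed
qed

text \<open>
  On each cell of length \<open>h\<close>, the value at an end point is at most \<open>\<bar>u s\<bar>\<close> plus the integral of
  \<open>\<bar>u'\<bar>\<close> over the cell, for every \<open>s\<close> in the cell. Averaging over \<open>s\<close> bounds the sum by \<open>L\<^sup>1\<close> norms,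
  because the cells are disjoint.
\<close>

lemma summable_grid_samples:
  assumes u: "derivs_in_L1 n u" and n: "n \<ge> 1" and h: "h > 0"
  shows "summable (\<lambda>l. \<bar>u (x - real (l + 1) * h)\<bar>)"
proof -
  obtain u' where u': "integrable lborel u'" and ftc: "\<And>a b. a \<le> b \<Longrightarrow> u b - u a
      = (LINT s:{a..b}|lborel. u' s)"
    using assms unfolding derivs_in_L1_def by (metis One_nat_def less_eq_Suc_le)
  have iu: "integrable lborel u" by (rule derivs_in_L1_integrable[OF u])
  define I where "I = (\<lambda>l. {x - real (l + 1) * h ..< x - real l * h})"
  define w where "w = (\<lambda>s. \<bar>u s\<bar> + h * \<bar>u' s\<bar>)"
  have w: "integrable lborel w" unfolding w_def using iu u' by auto
  have w0: "w s \<ge> 0" for s using h by (simp add: w_def)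
  have iw: "integrable lborel (\<lambda>s. indicator (I l) s * w s)" for l
    using integrable_mult_indicator[of "I l" lborel w] w by (simp add: I_def)
  have pt: "h * \<bar>u (x - real (l + 1) * h)\<bar> \<le> (LINT s|lborel. indicator (I l) s * w s)" for l
  proof -
    define a b where "a = x - real (l + 1) * h" and "b = x - real l * h"
    have ab: "b = a + h" by (simp add: a_def b_def algebra_simps)
    have I: "I l = {a..<b}" by (simp add: I_def a_def b_def)
    define V where "V = (LINT s|lborel. indicator (I l) s * \<bar>u' s\<bar>)"
    have iu1: "integrable lborel (\<lambda>s. indicator (I l) s * \<bar>u s\<bar>)"
      using integrable_mult_indicator[of "I l" lborel "\<lambda>s. \<bar>u s\<bar>"] iu by (simp add: I_def)
    have iu2: "integrable lborel (\<lambda>s. indicator (I l) s * \<bar>u' s\<bar>)"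
      using integrable_mult_indicator[of "I l" lborel "\<lambda>s. \<bar>u' s\<bar>"] u' by (simp add: I_def)
    have iI: "integrable lborel (indicator (I l) :: real \<Rightarrow> real)"
      using h by (intro integrable_real_indicator) (auto simp: I ab)
    have lI: "(LINT s|lborel. indicator (I l) s) = h"
      using h by (simp add: I ab)
    have le: "\<bar>u a\<bar> \<le> \<bar>u s\<bar> + V" if s: "s \<in> I l" for s
    proof -
      have as: "a \<le> s" "s < b" using s by (auto simp: I)
      have "\<bar>u s - u a\<bar> \<le> (LINT t|lborel. indicator {a..s} t * \<bar>u' t\<bar>)"
        by (rule increment_le_L1_norm[OF u' as(1) ftc[OF as(1)]])
      also have "\<dots> \<le> V"
        unfolding V_def
      proof (rule integral_mono[OF _ iu2])
        show "integrable lborel (\<lambda>t. indicator {a..s} t * \<bar>u' t\<bar>)"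
          using integrable_mult_indicator[of "{a..s}" lborel "\<lambda>s. \<bar>u' s\<bar>"] u' by simp
      qed (use as in \<open>auto simp: I indicator_def\<close>)
      finally show ?thesis by linarith
    qed
    have "h * \<bar>u a\<bar> = (LINT s|lborel. indicator (I l) s * \<bar>u a\<bar>)"
      using lI by simp
    also have "\<dots> \<le> (LINT s|lborel. indicator (I l) s * \<bar>u s\<bar> + V * indicator (I l) s)"
    proof (rule integral_mono)
      show "integrable lborel (\<lambda>s. indicator (I l) s * \<bar>u a\<bar>)" using iI by simp
      show "integrable lborel (\<lambda>s. indicator (I l) s * \<bar>u s\<bar> + V
          * indicator (I l) s)" using iI iu1 by simp
      show "indicator (I l) s * \<bar>u a\<bar> \<le> indicator (I l) s * \<bar>u s\<bar> + V * indicator (I l) s" for s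
        using le[of s] by (auto simp: indicator_def)
    qed
    also have "\<dots> = (LINT s|lborel. indicator (I l) s * \<bar>u s\<bar>) + V * h"
      using iu1 iI lI by simp
    also have "\<dots> = (LINT s|lborel. indicator (I l) s * w s)"
      using iu1 iu2 by (simp add: w_def V_def ring_distribs mult.left_commute[of _ h])
    finally show ?thesis by (simp add: a_def)
  qed
  have disj: "I i \<inter> I j = {}" if "i < j" for i j
  proof -
    have "real (i + 1) * h \<le> real j * h" using that h by (intro mult_right_mono) auto
    thus ?thesis by (auto simp: I_def)
  qed
  have ind: "(\<Sum>l<N. indicator (I l) s) \<le> (1::real)" for N s
  proof -
    have "disjoint_family_on I {..<N}"
      unfolding disjoint_family_on_def by (metis disj Int_commute nat_neq_iff)
    hence "(\<Sum>l<N. indicator (I l) s) = (indicator (\<Union>l<N. I l) s :: real)"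
      by (subst indicator_UN_disjoint) auto
    thus ?thesis by (simp add: indicator_def)
  qed
  have "(\<Sum>l<N. \<bar>u (x - real (l + 1) * h)\<bar>) \<le> (LINT s|lborel. w s) / h" for N
  proof -
    have "h * (\<Sum>l<N. \<bar>u (x - real (l + 1) * h)\<bar>) \<le> (\<Sum>l<N. LINT s|lborel. indicator (I l) s * w s)"
      unfolding sum_distrib_left by (intro sum_mono pt)
    also have "\<dots> = (LINT s|lborel. (\<Sum>l<N. indicator (I l) s * w s))"
      using iw by (subst Bochner_Integration.integral_sum) auto
    also have "\<dots> \<le> (LINT s|lborel. w s)"
    proof (rule integral_mono[OF _ w])
      show "integrable lborel (\<lambda>s. \<Sum>l<N. indicator (I l) s * w s)"
        by (intro Bochner_Integration.integrable_sum iw)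
      show "(\<Sum>l<N. indicator (I l) s * w s) \<le> w s" for s
        using mult_right_mono[OF ind[where N = N and s = s] w0] by (simp add: sum_distrib_right)
    qed
    finally show ?thesis using h by (simp add: field_simps)
  qed
  hence "(\<Sum>l\<le>N. \<bar>u (x - real (l + 1) * h)\<bar>) \<le> (LINT s|lborel. w s) / h" for N
    unfolding lessThan_Suc_atMost[symmetric] .
  thus ?thesis by (rule bounded_imp_summable[rotated]) simp
qed

text \<open>
  The generating function converges absolutely only inside the disc. With the weights \<open>r ^ l\<close>,
  \<open>r < 1\<close>, sum and inverse Fourier integral can be interchanged. Then \<open>r\<close> tends to \<open>1\<close>: in the
      sum by
  Tannery's theorem, since bounded coefficients and absolutely summable samples suffice, and in the
  integral by dominated convergence, since the power of \<open>gen_poly\<close> extends continuously to the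
      circle.
\<close>

lemma B_left_fourier:
  assumes \<alpha>: "\<alpha> > 0" and h: "h > 0" and u: "derivs_in_L1 n u" "n \<ge> 2"
      and cont: "continuous_on UNIV u"
  shows "of_real (2 * pi * h powr \<alpha> * B_left \<alpha> h u x)
    = inv_fourier (\<lambda>\<xi>. cis (- (h * \<xi>)) * gen_poly \<alpha> (cis (- (h * \<xi>))) powr of_real \<alpha>
        * fourier u \<xi>) x"
proof -
  have [measurable]: "u \<in> borel_measurable borel" using derivs_in_L1_integrable[OF u(1)] by auto
  have [measurable]: "gen_poly \<alpha> \<in> borel_measurable borel" unfolding gen_poly_def[abs_def]
      by measurable
  have iF: "integrable lborel (fourier u)" by (rule integrable_fourier[OF u])
  obtain M where M: "\<And>z. norm z \<le> 1 \<Longrightarrow> norm (gen_poly \<alpha> z powr of_real \<alpha>) \<le> M"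
    using gen_poly_bounded[OF \<alpha>] by blast
  have M0: "M \<ge> 0" by (rule order_trans[OF norm_ge_zero M[of 0]]) simp
  have k: "\<bar>kappa2 \<alpha> l\<bar> \<le> M" for l by (rule kappa2_bounded[OF \<alpha> M])
  define v where "v = (\<lambda>l. kappa2 \<alpha> l * u (x - real (l + 1) * h))"
  define P where "P = (\<lambda>r \<xi>. gen_poly \<alpha> (of_real r * cis (- (h * \<xi>))) powr of_real \<alpha>
      * (cis (- (h * \<xi>)) * (fourier u \<xi> * cis (\<xi> * x))))"
  have [measurable]: "P r \<in> borel_measurable borel" for r unfolding P_def by measurable
  have sumv: "summable (\<lambda>l. M * \<bar>u (x - real (l + 1) * h)\<bar>)"
    using summable_grid_samples[OF u(1) _ h] u by (intro summable_mult) auto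
  have v_le: "\<bar>v l\<bar> \<le> M * \<bar>u (x - real (l + 1) * h)\<bar>" for l
    unfolding v_def abs_mult by (intro mult_right_mono k) auto
  have lim1: "((\<lambda>r. \<Sum>l. of_real (r ^ l * v l)) \<longlongrightarrow> (\<Sum>l. complex_of_real (v l))) (at_left 1)"
  proof (rule tannerys_theorem[THEN conjunct2, THEN conjunct2])
    show "((\<lambda>r. complex_of_real (r ^ l * v l)) \<longlongrightarrow> complex_of_real (v l)) (at_left 1)" for l
      by (auto intro!: tendsto_eq_intros)
    have "norm (complex_of_real (r ^ l * v l)) \<le> M * \<bar>u (x - real (l + 1) * h)\<bar>"
        if "r \<in> {0<..<1}" for l r
    proof -
      have "\<bar>r ^ l * v l\<bar> \<le> 1 * \<bar>v l\<bar>"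
        unfolding abs_mult using that by (intro mult_right_mono) (auto simp: power_abs intro!:
            power_le_one)
      also have "\<dots> \<le> M * \<bar>u (x - real (l + 1) * h)\<bar>" using v_le by simp
      finally show ?thesis unfolding norm_of_real .
    qed
    thus "\<forall>\<^sub>F (l, r) in at_top \<times>\<^sub>F at_left (1::real). norm (complex_of_real (r ^ l * v l))
        \<le> M * \<bar>u (x - real (l + 1) * h)\<bar>"
      unfolding case_prod_unfold
      by (intro eventually_prodI[OF eventually_True eventually_at_left_real[of 0 1], THEN
          eventually_mono]) auto
  qed (use sumv in auto)
  have powser: "of_real (2 * pi) * (\<Sum>l. of_real (r ^ l * v l)) = (LINT \<xi>|lborel. P r \<xi>)"
      if r: "r \<in> {0<..<1}" for r
  proof -
    define T where "T = (\<lambda>l \<xi>. of_real (kappa2 \<alpha> l * r ^ l) * (fourier u \<xi> * cis (\<xi> * (x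
        - real (l + 1) * h))))"
    have nT: "norm (T l \<xi>) \<le> M * r ^ l * norm (fourier u \<xi>)" for l \<xi>
      using k[of l] r by (auto simp: T_def norm_mult norm_power abs_mult intro!: mult_right_mono)
    have geo: "summable (\<lambda>l. M * r ^ l * c)" for c
      using r by (intro summable_mult summable_mult2 summable_geometric) auto
    have iT: "integrable lborel (T l)" for l
      unfolding T_def by (intro integrable_mult_right integrable_mult_cis iF) auto
    have "(\<lambda>l. LINT \<xi>|lborel. T l \<xi>) sums (LINT \<xi>|lborel. (\<Sum>l. T l \<xi>))"
    proof (rule sums_integral[OF iT])
      show "AE \<xi> in lborel. summable (\<lambda>l. norm (T l \<xi>))"
        by (intro AE_I2 summable_comparison_test'[OF geo]) (use nT in auto)
      show "summable (\<lambda>l. LINT \<xi>|lborel. norm (T l \<xi>))"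
      proof (rule summable_comparison_test'[OF geo])
        fix l :: nat
        have "(LINT \<xi>|lborel. norm (T l \<xi>)) \<le> (LINT \<xi>|lborel. M * r ^ l * norm (fourier u \<xi>))"
          by (intro integral_mono nT integrable_norm integrable_mult_right iT iF)
        thus "norm (LINT \<xi>|lborel. norm (T l \<xi>)) \<le> M * r ^ l * (LINT \<xi>|lborel. norm (fourier u \<xi>))"
          by (simp add: integral_nonneg_AE)
      qed
    qed
    moreover have "(LINT \<xi>|lborel. T l \<xi>) = of_real (2 * pi) * of_real (r ^ l * v l)" for l
    proof -
      have "(LINT \<xi>|lborel. T l \<xi>) = of_real (kappa2 \<alpha> l * r ^ l) * inv_fourier (fourier u) (x
          - real (l + 1) * h)"
        unfolding T_def inv_fourier_def by (rule integral_mult_right_zero)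
      thus ?thesis unfolding derivs_in_L1_inversion[OF u cont] v_def by (simp add: mult_ac)
    qed
    moreover have "(\<Sum>l. T l \<xi>) = P r \<xi>" for \<xi>
    proof -
      define z where "z = of_real r * cis (- (h * \<xi>))"
      have "norm z < 1" using r by (simp add: z_def norm_mult)
      hence "(\<lambda>l. of_real (kappa2 \<alpha> l) * z ^ l) sums (gen_poly \<alpha> z powr of_real \<alpha>)"
        by (rule kappa2_sums[OF \<alpha>])
      hence "(\<lambda>l. of_real (kappa2 \<alpha> l) * z ^ l * (cis (- (h * \<xi>)) * (fourier u \<xi> * cis (\<xi>
          * x)))) sums P r \<xi>"
        unfolding P_def z_def by (rule sums_mult2)
      also have "(\<lambda>l. of_real (kappa2 \<alpha> l) * z ^ l * (cis (- (h * \<xi>)) * (fourier u \<xi> * cis (\<xi>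
          * x)))) = (\<lambda>l. T l \<xi>)"
      proof
        fix l
        have "cis (\<xi> * (x - real (l + 1) * h))
            = cis (- (h * \<xi>)) ^ l * (cis (- (h * \<xi>)) * cis (\<xi> * x))"
          by (simp only: Complex.DeMoivre cis_mult) (simp add: algebra_simps)
        thus "of_real (kappa2 \<alpha> l) * z ^ l * (cis (- (h * \<xi>)) * (fourier u \<xi> * cis (\<xi> * x)))
            = T l \<xi>"
          unfolding T_def z_def power_mult_distrib by simp
      qed
      finally show ?thesis by (rule sums_unique[symmetric])
    qed
    ultimately have "(\<lambda>l. of_real (2 * pi) * complex_of_real (r ^ l * v l))
        sums (LINT \<xi>|lborel. P r \<xi>)"
      by simp
    moreover have "summable (\<lambda>l. complex_of_real (r ^ l * v l))"
    proof (rule summable_comparison_test'[OF sumv])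
      fix l :: nat
      have "\<bar>r ^ l * v l\<bar> \<le> 1 * \<bar>v l\<bar>"
        unfolding abs_mult using r by (intro mult_right_mono) (auto simp: power_abs intro!:
            power_le_one)
      thus "norm (complex_of_real (r ^ l * v l)) \<le> M * \<bar>u (x - real (l + 1) * h)\<bar>"
        using v_le[of l] unfolding norm_of_real by linarith
    qed
    ultimately show ?thesis
      using suminf_mult sums_unique by metis
  qed
  have lim2: "((\<lambda>r. LINT \<xi>|lborel. P r \<xi>) \<longlongrightarrow> (LINT \<xi>|lborel. P 1 \<xi>)) (at 1 within {0<..<1})"
  proof (rule tendsto_integral_dominated_within[where w = "\<lambda>\<xi>. M * norm (fourier u \<xi>)"])
    show "integrable lborel (\<lambda>\<xi>. M * norm (fourier u \<xi>))"
      by (intro integrable_mult_right integrable_norm iF)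
    show "AE \<xi> in lborel. ((\<lambda>r. P r \<xi>) \<longlongrightarrow> P 1 \<xi>) (at 1 within {0<..<1})"
    proof (intro AE_I2)
      fix \<xi>
      have "((\<lambda>r. gen_poly \<alpha> (of_real r * cis (- (h * \<xi>))))
          \<longlongrightarrow> gen_poly \<alpha> (of_real 1 * cis (- (h * \<xi>)))) (at 1 within {0<..<1})"
        unfolding gen_poly_def by (intro tendsto_intros)
      hence "((\<lambda>r. gen_poly \<alpha> (of_real r * cis (- (h * \<xi>))) powr of_real \<alpha>)
          \<longlongrightarrow> gen_poly \<alpha> (of_real 1 * cis (- (h * \<xi>))) powr of_real \<alpha>) (at 1 within {0<..<1})"
        using gen_poly_closed_disc[OF \<alpha>, of "cis (- (h * \<xi>))"] \<alpha>
            by (intro tendsto_powr_complex') auto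
      thus "((\<lambda>r. P r \<xi>) \<longlongrightarrow> P 1 \<xi>) (at 1 within {0<..<1})"
        unfolding P_def by (intro tendsto_mult tendsto_const)
    qed
    show "AE \<xi> in lborel. norm (P r \<xi>) \<le> M * norm (fourier u \<xi>)" if "r \<in> {0<..<1}" for r
    proof (intro AE_I2)
      fix \<xi>
      have "norm (gen_poly \<alpha> (of_real r * cis (- (h * \<xi>))) powr of_real \<alpha>) \<le> M"
        by (rule M) (use that in \<open>simp add: norm_mult\<close>)
      thus "norm (P r \<xi>) \<le> M * norm (fourier u \<xi>)"
        by (simp add: P_def norm_mult mult_right_mono)
    qed
  qed measurable
  have at: "at 1 within {0<..<1} = at_left (1::real)"
    by (rule at_within_nhd[of _ "{0<..}"]) auto
  have "((\<lambda>r. of_real (2 * pi) * (\<Sum>l. of_real (r ^ l * v l)))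
      \<longlongrightarrow> of_real (2 * pi) * (\<Sum>l. complex_of_real (v l))) (at_left 1)"
    by (intro tendsto_mult tendsto_const lim1)
  moreover have "((\<lambda>r. of_real (2 * pi) * (\<Sum>l. of_real (r ^ l * v l)))
      \<longlongrightarrow> (LINT \<xi>|lborel. P 1 \<xi>)) (at_left 1)"
    by (rule Lim_transform_eventually[OF lim2[unfolded at]])
       (intro eventually_mono[OF eventually_at_left_real[of 0 1]], auto simp: powser simp del:
           of_real_mult)
  ultimately have "of_real (2 * pi) * (\<Sum>l. complex_of_real (v l)) = (LINT \<xi>|lborel. P 1 \<xi>)"
    by (rule tendsto_unique[OF trivial_limit_at_left_real])
  moreover have "(\<Sum>l. complex_of_real (v l)) = of_real (\<Sum>l. v l)"
    by (rule suminf_of_real[symmetric])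
       (rule summable_comparison_test'[OF sumv], use v_le in simp)
  moreover have "h powr \<alpha> * B_left \<alpha> h u x = (\<Sum>l. v l)"
    using h by (simp add: B_left_def v_def)
  ultimately show ?thesis
    by (simp add: inv_fourier_def P_def mult_ac)
qed

section \<open>The error estimate\<close>

text \<open>
  The error has the Fourier multiplier \<open>h powr - \<alpha> * symbol_err \<alpha> (h * \<xi>)\<close>, which is bounded by a
  constant times \<open>h ^ 3 * \<bar>\<xi>\<bar> powr (\<alpha> + 3)\<close>. Six integrable derivatives make the remaining integral
  finite because \<open>\<alpha> + 3 < 5\<close>.
\<close>

lemma left_error_bound:
  assumes \<alpha>: "1 < \<alpha>" "\<alpha> < 2" and u: "derivs_in_L1 6 u" and cont: "continuous_on UNIV u"
  shows "\<exists>C. \<forall>h>0. \<forall>x. \<bar>B_left \<alpha> h u x - L_op \<alpha> h (RL_left \<alpha> u) x\<bar> \<le> C * h ^ 3"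
proof -
  have \<alpha>0: "\<alpha> > 0" using \<alpha> by simp
  have [measurable]: "u \<in> borel_measurable borel" using derivs_in_L1_integrable[OF u] by auto
  have [measurable]: "gen_poly \<alpha> \<in> borel_measurable borel" unfolding gen_poly_def[abs_def]
      by measurable
  have iF: "integrable lborel (fourier u)" by (rule integrable_fourier[OF u]) simp
  obtain C where C: "\<And>\<theta>. norm (symbol_err \<alpha> \<theta>) \<le> C * \<bar>\<theta>\<bar> powr (\<alpha> + 3)"
    using symbol_err_bound[OF \<alpha>0] by blast
  define W where "W = (\<lambda>\<xi>. \<bar>\<xi>\<bar> powr (\<alpha> + 3) * norm (fourier u \<xi>))"
  have iW: "integrable lborel W"
    unfolding W_def by (rule integrable_weighted_fourier[OF u]) (use \<alpha> in auto)
  define R where "R = (\<lambda>\<xi>. (\<i> * of_real \<xi>) powr of_real \<alpha> * fourier u \<xi>)"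
  have iR: "integrable lborel R"
  proof (rule Bochner_Integration.integrable_bound[OF integrable_weighted_fourier[OF u, of \<alpha>]])
    show "R \<in> borel_measurable lborel" unfolding R_def by measurable
    show "AE \<xi> in lborel. norm (R \<xi>) \<le> norm (\<bar>\<xi>\<bar> powr \<alpha> * norm (fourier u \<xi>))"
      by (simp add: R_def norm_mult norm_i_powr)
  qed (use \<alpha> in auto)
  have RL: "2 * pi * RL_left \<alpha> u y = Re (inv_fourier R y)" for y
    unfolding R_def by (rule RL_left_fourier[OF \<alpha> u _ cont]) simp
  have "\<bar>B_left \<alpha> h u x - L_op \<alpha> h (RL_left \<alpha> u) x\<bar> \<le> (C / (2 * pi) * (LINT \<xi>|lborel. W \<xi>)) * h ^ 3"
    if h: "h > 0" for h x
  proof -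
    define Q where "Q = (\<lambda>\<xi>. cis (- (h * \<xi>)) * gen_poly \<alpha> (cis (- (h * \<xi>))) powr of_real \<alpha>
        * fourier u \<xi>)"
    obtain M where M: "\<And>z. norm z \<le> 1 \<Longrightarrow> norm (gen_poly \<alpha> z powr of_real \<alpha>) \<le> M"
      using gen_poly_bounded[OF \<alpha>0] by blast
    have iQ: "integrable lborel Q"
    proof (rule Bochner_Integration.integrable_bound[OF integrable_mult_right[OF iF, of "of_real
        M"]])
      show "Q \<in> borel_measurable lborel" unfolding Q_def by measurable
      show "AE \<xi> in lborel. norm (Q \<xi>) \<le> norm (of_real M * fourier u \<xi>)"
        using M by (intro AE_I2) (auto simp: Q_def norm_mult intro!: mult_right_mono
            order_trans[OF M abs_ge_self])
    qed
    define s where "s = sigma2 \<alpha>"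
    have Lop: "2 * pi * L_op \<alpha> h (RL_left \<alpha> u) x
       = Re (inv_fourier R x) + s * (Re (inv_fourier R (x + h)) - 2 * Re (inv_fourier R x)
           + Re (inv_fourier R (x - h)))"
    proof -
      have a: "h\<^sup>2 * delta_sq h (RL_left \<alpha> u) x
          = RL_left \<alpha> u (x + h) - 2 * RL_left \<alpha> u x + RL_left \<alpha> u (x - h)"
        using h by (simp add: delta_sq_def)
      thus ?thesis
        unfolding L_op_def mult.assoc[of "sigma2 \<alpha>" "h\<^sup>2"] a s_def RL[symmetric]
            by (simp add: algebra_simps)
    qed
    have iRc: "integrable lborel (\<lambda>\<xi>. R \<xi> * cis (\<xi> * y))" for y
      by (intro integrable_mult_cis iR) auto
    have iQc: "integrable lborel (\<lambda>\<xi>. Q \<xi> * cis (\<xi> * x))"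
      by (intro integrable_mult_cis iQ) auto
    define E where "E = (\<lambda>\<xi>. Q \<xi> * cis (\<xi> * x) - of_real (h powr \<alpha>) * (R \<xi> * cis (\<xi> * x)
        + of_real s *
        (R \<xi> * cis (\<xi> * (x + h)) - 2 * (R \<xi> * cis (\<xi> * x)) + R \<xi> * cis (\<xi> * (x - h)))))"
    have E: "(LINT \<xi>|lborel. E \<xi>) = inv_fourier Q x - of_real (h powr \<alpha>) * (inv_fourier R x
        + of_real s *
        (inv_fourier R (x + h) - 2 * inv_fourier R x + inv_fourier R (x - h)))"
      unfolding E_def inv_fourier_def using iQc iRc by simp
    have E_sym: "E \<xi> = symbol_err \<alpha> (h * \<xi>) * (fourier u \<xi> * cis (\<xi> * x))" for \<xi>
    proof -
      have c: "cis (\<xi> * (x + h)) = cis (h * \<xi>) * cis (\<xi> * x)" "cis (\<xi> * (x - h))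
          = cis (- (h * \<xi>)) * cis (\<xi> * x)"
        by (simp_all add: cis_mult algebra_simps)
      have "(\<i> * of_real (h * \<xi>)) powr of_real \<alpha> = (of_real h * (\<i> * of_real \<xi>)) powr of_real \<alpha>"
        by (simp add: mult_ac)
      also have "\<dots> = of_real h powr of_real \<alpha> * (\<i> * of_real \<xi>) powr of_real \<alpha>"
        using h by (intro powr_times_real_left) auto
      also have "of_real h powr of_real \<alpha> = complex_of_real (h powr \<alpha>)"
        using h by (simp add: powr_of_real)
      finally have p: "(\<i> * of_real (h * \<xi>)) powr of_real \<alpha>
          = of_real (h powr \<alpha>) * (\<i> * of_real \<xi>) powr of_real \<alpha>" .
      show ?thesis unfolding E_def symbol_err_def p c Q_def R_def s_def by (simp add: algebra_simps)
    qed
    have nE: "norm (E \<xi>) \<le> C * h powr (\<alpha> + 3) * W \<xi>" for \<xi>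
    proof -
      have "norm (E \<xi>) = norm (symbol_err \<alpha> (h * \<xi>)) * norm (fourier u \<xi>)"
        by (simp add: E_sym norm_mult)
      also have "\<dots> \<le> (C * \<bar>h * \<xi>\<bar> powr (\<alpha> + 3)) * norm (fourier u \<xi>)"
        by (intro mult_right_mono C) auto
      also have "\<dots> = C * h powr (\<alpha> + 3) * W \<xi>"
        using h by (simp add: W_def abs_mult powr_mult)
      finally show ?thesis .
    qed
    have iE: "integrable lborel E"
      unfolding E_def using iQc iRc by simp
    have "norm (LINT \<xi>|lborel. E \<xi>) \<le> (LINT \<xi>|lborel. C * h powr (\<alpha> + 3) * W \<xi>)"
      by (rule order_trans[OF integral_norm_bound])
         (intro integral_mono nE integrable_norm iE integrable_mult_right iW)
    also have "\<dots> = h powr \<alpha> * (C * (LINT \<xi>|lborel. W \<xi>) * h ^ 3)"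
      using h by (simp add: powr_add)
    finally have nI: "norm (LINT \<xi>|lborel. E \<xi>) \<le> h powr \<alpha> * (C * (LINT \<xi>|lborel. W \<xi>) * h ^ 3)" .
    have "of_real (2 * pi * h powr \<alpha> * B_left \<alpha> h u x) = inv_fourier Q x"
      unfolding Q_def by (rule B_left_fourier[OF \<alpha>0 h u _ cont]) simp
    from this[symmetric] have "2 * pi * h powr \<alpha> * B_left \<alpha> h u x = Re (inv_fourier Q x)"
      by (simp only: Re_complex_of_real)
    hence "h powr \<alpha> * (2 * pi * (B_left \<alpha> h u x - L_op \<alpha> h (RL_left \<alpha> u) x))
        = Re (LINT \<xi>|lborel. E \<xi>)"
      unfolding E right_diff_distrib Lop by (simp add: algebra_simps)
    hence "h powr \<alpha> * \<bar>2 * pi * (B_left \<alpha> h u x - L_op \<alpha> h (RL_left \<alpha> u) x)\<bar>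
        \<le> norm (LINT \<xi>|lborel. E \<xi>)"
      using abs_Re_le_cmod[of "LINT \<xi>|lborel. E \<xi>"] by (simp add: abs_mult)
    also note nI
    finally have "\<bar>2 * pi * (B_left \<alpha> h u x - L_op \<alpha> h (RL_left \<alpha> u) x)\<bar>
        \<le> C * (LINT \<xi>|lborel. W \<xi>) * h ^ 3"
      using h by simp
    hence "2 * pi * \<bar>B_left \<alpha> h u x - L_op \<alpha> h (RL_left \<alpha> u) x\<bar> \<le> C * (LINT \<xi>|lborel. W \<xi>) * h ^ 3"
      unfolding abs_mult by simp
    thus ?thesis by (simp add: field_simps)
  qed
  thus ?thesis by blast
qed

lemma derivs_in_L1_reflect:
  assumes "derivs_in_L1 n u"
  shows "derivs_in_L1 n (\<lambda>x. u (- x))"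
proof -
  obtain D where D0: "D 0 = u" and D1: "\<forall>j\<le>n. integrable lborel (D j)"
    and D2: "\<forall>j<n. \<forall>a b. a \<le> b \<longrightarrow> D j b - D j a = (LINT s:{a..b}|lborel. D (Suc j) s)"
    using assms unfolding derivs_in_L1_def by (elim exE conjE)
  define E where "E = (\<lambda>j x. (-1) ^ j * D j (- x))"
  have "integrable lborel (E j)" if "j \<le> n" for j
    using lborel_integrable_real_affine[of "D j" "-1" 0] D1 that
    by (auto simp: E_def intro!: integrable_mult_right)
  moreover have "E j b - E j a = (LINT s:{a..b}|lborel. E (Suc j) s)" if "j < n" "a \<le> b" for j a b
  proof -
    have "D j (- a) - D j (- b) = (LINT s:{-b..-a}|lborel. D (Suc j) s)"
      using D2 that by simp
    also have "\<dots> = (LINT s|lborel. indicator {a..b} s *\<^sub>R D (Suc j) (- s))"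
      unfolding set_lebesgue_integral_def
      by (subst lborel_integral_real_affine[where c = "-1" and t = 0])
         (auto simp: indicator_def intro!: Bochner_Integration.integral_cong)
    finally have "E j b - E j a = - ((-1) ^ j) * (LINT s|lborel. indicator {a..b} s *\<^sub>R D
        (Suc j) (- s))"
      by (simp add: E_def algebra_simps flip: right_diff_distrib)
    also have "\<dots> = (LINT s:{a..b}|lborel. E (Suc j) s)"
      unfolding set_lebesgue_integral_def E_def
      by (subst integral_mult_right_zero[symmetric]) (simp add: mult_ac)
    finally show ?thesis .
  qed
  moreover have "E 0 = (\<lambda>x. u (- x))" by (simp add: E_def D0)
  ultimately show ?thesis unfolding derivs_in_L1_def by blast
qed

theorem theorem2p7:
  fixes \<alpha> :: real and u :: "real \<Rightarrow> real"
  assumes "1 < \<alpha>" and "\<alpha> < 2"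
    and "C_k (nat \<lfloor>\<alpha>\<rfloor> + 4) u"
    and "derivs_in_L1 (nat \<lfloor>\<alpha>\<rfloor> + 5) u"
  shows "(\<exists>C. \<forall>\<^sub>F h in at_right 0. \<forall>x.
            \<bar>B_left \<alpha> h u x - L_op \<alpha> h (RL_left \<alpha> u) x\<bar> \<le> C * h ^ 3) \<and>
         (\<exists>C. \<forall>\<^sub>F h in at_right 0. \<forall>x.
            \<bar>B_right \<alpha> h u x - L_op \<alpha> h (RL_right \<alpha> u) x\<bar> \<le> C * h ^ 3)"
proof -
  have fl: "\<lfloor>\<alpha>\<rfloor> = 1" using assms by linarith
  have u: "derivs_in_L1 6 u" using assms(4) by (simp add: fl)
  have cont: "continuous_on UNIV u"
  proof -
    have "u differentiable (at x)" for x
    proof -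
      have "\<forall>j<nat \<lfloor>\<alpha>\<rfloor> + 4. \<forall>x. (deriv ^^ j) u differentiable (at x)"
        using assms(3) by (simp add: C_k_def)
      from this[rule_format, of 0 x] show ?thesis by simp
    qed
    thus ?thesis
      by (auto intro!: continuous_at_imp_continuous_on differentiable_imp_continuous_within)
  qed
  define v where "v = (\<lambda>x. u (- x))"
  have v: "derivs_in_L1 6 v" unfolding v_def by (rule derivs_in_L1_reflect[OF u])
  have contv: "continuous_on UNIV v"
    unfolding v_def by (intro continuous_on_compose2[OF cont] continuous_intros) auto
  obtain C1 where C1: "\<forall>h>0. \<forall>x. \<bar>B_left \<alpha> h u x - L_op \<alpha> h (RL_left \<alpha> u) x\<bar> \<le> C1 * h ^ 3"
    using left_error_bound[OF assms(1,2) u cont] by blast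
  obtain C2 where C2: "\<forall>h>0. \<forall>x. \<bar>B_left \<alpha> h v x - L_op \<alpha> h (RL_left \<alpha> v) x\<bar> \<le> C2 * h ^ 3"
    using left_error_bound[OF assms(1,2) v contv] by blast
  \<comment> \<open>The right-sided operators are the left-sided ones for the reflected function.\<close>
  have B: "B_right \<alpha> h u x = B_left \<alpha> h v (- x)" for h x
    by (simp add: B_right_def B_left_def v_def algebra_simps)
  have RL: "RL_right \<alpha> u x = RL_left \<alpha> v (- x)" for x
    by (rule RL_right_reflect[OF assms(1,2) v _ contv]) (auto simp: v_def)
  have L: "L_op \<alpha> h (RL_right \<alpha> u) x = L_op \<alpha> h (RL_left \<alpha> v) (- x)" for h x
  proof -
    have "- (x + h) = - x - h" "- (x - h) = - x + h" by simp_all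
    thus ?thesis unfolding L_op_def delta_sq_def RL by (simp only:) (simp add: algebra_simps)
  qed
  have ev: "\<forall>\<^sub>F h in at_right (0::real). h > 0" by (rule eventually_at_right_less)
  show ?thesis
    by (intro conjI exI[of _ C1] exI[of _ C2] eventually_mono[OF ev]) (use C1 C2 in \<open>auto simp: B L\<close>)
qed

end
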